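(* Let $\lambda_1,\lambda_2>0$, $F(p)=\sqrt{\lambda_1^2p_1^2+\lambda_2^2p_2^2}$, $A\in\mathbb{R}$ and $\mathbf{p}_0\in\mathbb{R}^2\setminus\{(0,0)\}$. There exists a positive constant $L_0$ depending on $A$, $\tilde r(\mathbf{p}_0)$, $\lambda_1$ and $\lambda_2$ such that the Euclidean arclength of the (unique up to reparametrization) minimizer $\gamma_\beta$ of $\inf_{\gamma\in\mathcal{S}_{A,\mathbf{p}_0}}E(\gamma)$ is bounded by $L_0$.
   Context: For a Lipschitz curve $\gamma=(\gamma^{(1)},\gamma^{(2)}):[0,1]\to\mathbb{R}^2$: $E(\gamma)=\int_0^1F(\gamma)|\gamma'|\,dt$ and $\mathcal{P}(\gamma)=-\int_0^1\gamma^{(2)}(\gamma^{(1)})'\,dt$. $\mathcal{S}_{A,\mathbf{p}_0}$ is the set of locally Lipschitz $\gamma:[0,1]\to\mathbb{R}^2$ with $\gamma(0)=\mathbf{p}_0$, $\gamma(1)=(0,0)$, $\mathcal{P}(\gamma)=A$. Also $\tilde r(p)=\frac12(\lambda_1p_1^2+\lambda_2p_2^2)$. The minimizer $\gamma_\beta$ is the curve, with image that of the solution starting at $\mathbf{p}_0$ and tending to the origin of the linear system $$\gamma'=\begin{pmatrix}-\lambda_1\sin\beta&-\lambda_2\cos\beta\\ \lambda_1\cos\beta&-\lambda_2\sin\beta\end{pmatrix}\gamma ,$$ where $\beta\in(0,\pi)$ is determined by $\frac{\tilde r(\mathbf{p}_0)}{\lambda_1+\lambda_2}\cot\beta=\tilde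 A$ and $\tilde A:=A-\int_{\sigma}(\omega_0-\omega_1)$, with $\omega_0=-p_2\,dp_1$, $\omega_1=\frac{1}{\lambda_1+\lambda_2}(-\lambda_2p_2\,dp_1+\lambda_1p_1\,dp_2)$ and $\sigma$ any curve from $\mathbf{p}_0$ to the origin (the value does not depend on $\sigma$). *)

theory Defs
  imports "HOL-Analysis.Analysis"
begin

text \<open>
  Curves are functions \<^typ>\<open>real \<Rightarrow> real^2\<close> of which only the restriction to \<open>[0,1]\<close> matters;
  derivatives are therefore taken within \<open>{0..1}\<close>. They exist almost everywhere for the
  (locally) Lipschitz curves considered here; the unspecified value of
  \<^const>\<open>vector_derivative\<close> on the remaining null set does not affect the integrals below.
\<close>

abbreviation curve_deriv :: "(real \<Rightarrow> real^2) \<Rightarrow> real \<Rightarrow> real^2" where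
  "curve_deriv \<gamma> t \<equiv> vector_derivative \<gamma> (at t within {0..1})"

definition locally_lipschitz_on :: "real set \<Rightarrow> (real \<Rightarrow> real^2) \<Rightarrow> bool" where
  "locally_lipschitz_on T \<gamma> \<longleftrightarrow> (\<forall>t\<in>T. \<exists>u>0. \<exists>L. L-lipschitz_on (ball t u \<inter> T) \<gamma>)"

definition arclength :: "(real \<Rightarrow> real^2) \<Rightarrow> real" where
  "arclength \<gamma> = integral {0..1} (\<lambda>t. norm (curve_deriv \<gamma> t))"

definition weight :: "real \<Rightarrow> real \<Rightarrow> real^2 \<Rightarrow> real" where
  "weight l1 l2 p = sqrt (l1\<^sup>2 * (p$1)\<^sup>2 + l2\<^sup>2 * (p$2)\<^sup>2)"

definition energy :: "(real^2 \<Rightarrow> real) \<Rightarrow> (real \<Rightarrow> real^2) \<Rightarrow> real" where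
  "energy F \<gamma> = integral {0..1} (\<lambda>t. F (\<gamma> t) * norm (curve_deriv \<gamma> t))"

definition area :: "(real \<Rightarrow> real^2) \<Rightarrow> real" where
  "area \<gamma> = - integral {0..1} (\<lambda>t. \<gamma> t $ 2 * curve_deriv \<gamma> t $ 1)"

definition admissible :: "real \<Rightarrow> real^2 \<Rightarrow> (real \<Rightarrow> real^2) set" where
  "admissible A p0 = {\<gamma>. locally_lipschitz_on {0..1} \<gamma> \<and> \<gamma> 0 = p0 \<and> \<gamma> 1 = 0 \<and> area \<gamma> = A}"

definition minimizer :: "real \<Rightarrow> real \<Rightarrow> real \<Rightarrow> real^2 \<Rightarrow> (real \<Rightarrow> real^2) \<Rightarrow> bool" where
  "minimizer l1 l2 A p0 \<gamma> \<longleftrightarrow>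
     is_arg_min (energy (weight l1 l2)) (\<lambda>\<eta>. \<eta> \<in> admissible A p0) \<gamma>"

definition rtilde :: "real \<Rightarrow> real \<Rightarrow> real^2 \<Rightarrow> real" where
  "rtilde l1 l2 p = (l1 * (p$1)\<^sup>2 + l2 * (p$2)\<^sup>2) / 2"

text \<open>A 1-form \<open>a dp\<^sub>1 + b dp\<^sub>2\<close> is represented by its coefficient field \<open>p \<mapsto> (a p, b p)\<close>.\<close>

definition line_integral :: "(real^2 \<Rightarrow> real^2) \<Rightarrow> (real \<Rightarrow> real^2) \<Rightarrow> real" where
  "line_integral \<omega> \<sigma> = integral {0..1} (\<lambda>t. \<omega> (\<sigma> t) \<bullet> curve_deriv \<sigma> t)"

definition omega0 :: "real^2 \<Rightarrow> real^2" where
  "omega0 p = vector [- (p$2), 0]"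

definition omega1 :: "real \<Rightarrow> real \<Rightarrow> real^2 \<Rightarrow> real^2" where
  "omega1 l1 l2 p = (1 / (l1 + l2)) *\<^sub>R vector [- l2 * p$2, l1 * p$1]"

text \<open>
  \<open>\<omega>\<^sub>0 - \<omega>\<^sub>1 = - \<lambda>\<^sub>1 / (\<lambda>\<^sub>1 + \<lambda>\<^sub>2) d(p\<^sub>1 p\<^sub>2)\<close> is exact, so every curve \<open>\<sigma>\<close> from \<open>p\<^sub>0\<close> to the origin
  gives the same value; the straight segment is used.
\<close>

definition Atilde :: "real \<Rightarrow> real \<Rightarrow> real \<Rightarrow> real^2 \<Rightarrow> real" where
  "Atilde l1 l2 A p0 = A - line_integral (\<lambda>p. omega0 p - omega1 l1 l2 p) (linepath p0 0)"

definition system_matrix :: "real \<Rightarrow> real \<Rightarrow> real \<Rightarrow> real^2^2" where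
  "system_matrix l1 l2 \<beta> =
     vector [vector [- l1 * sin \<beta>, - l2 * cos \<beta>],
             vector [l1 * cos \<beta>, - l2 * sin \<beta>]]"

text \<open>
  The solution runs over \<open>[0,\<infinity>)\<close> and reaches the origin only in the limit, whereas a curve on
  \<open>[0,1]\<close> attains it at time 1; hence the added point 0 in the trace.
\<close>

definition has_spiral_trace :: "real \<Rightarrow> real \<Rightarrow> real \<Rightarrow> real^2 \<Rightarrow> (real \<Rightarrow> real^2) \<Rightarrow> bool" where
  "has_spiral_trace l1 l2 A p0 \<gamma> \<longleftrightarrow>
     (\<exists>\<beta>. 0 < \<beta> \<and> \<beta> < pi \<and> rtilde l1 l2 p0 / (l1 + l2) * cot \<beta> = Atilde l1 l2 A p0 \<and>
       (\<exists>x. x 0 = p0 \<and>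
            (\<forall>t\<ge>0. (x has_vector_derivative system_matrix l1 l2 \<beta> *v x t) (at t within {0..})) \<and>
            (x \<longlongrightarrow> 0) at_top \<and>
            \<gamma> ` {0..1} = insert 0 (x ` {0..})))"

text \<open>
  Lipschitz curves may rest on subintervals, so equality up to reparametrization is expressed by a
  common curve of which both are monotone, not necessarily injective, reparametrizations.
\<close>

definition monotone_reparam :: "(real \<Rightarrow> real) \<Rightarrow> bool" where
  "monotone_reparam \<phi> \<longleftrightarrow>
     continuous_on {0..1} \<phi> \<and> mono_on {0..1} \<phi> \<and> \<phi> 0 = 0 \<and> \<phi> 1 = 1"

definition same_up_to_reparam :: "(real \<Rightarrow> real^2) \<Rightarrow> (real \<Rightarrow> real^2) \<Rightarrow> bool" where
  "same_up_to_reparam \<gamma> \<delta> \<longleftrightarrow>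
     (\<exists>\<eta> \<phi> \<psi>. continuous_on {0..1} \<eta> \<and> monotone_reparam \<phi> \<and> monotone_reparam \<psi> \<and>
        (\<forall>t\<in>{0..1}. \<gamma> t = \<eta> (\<phi> t) \<and> \<delta> t = \<eta> (\<psi> t)))"

end

theory Submission imports Defs begin

text \<open>
  Write \<open>r\<close> for \<^const>\<open>rtilde\<close>, \<open>F\<close> for \<^const>\<open>weight\<close> and \<open>M\<close> for \<^const>\<open>system_matrix\<close> at an angle \<open>\<beta>\<close>.
  The vector \<open>M p\<close> is the gradient of \<open>r\<close> at \<open>p\<close> turned by the angle \<open>\<beta> + pi/2\<close>, and the gradient has norm \<open>F p\<close>.
  This makes \<open>M\<close> a calibration. Along a curve \<open>\<gamma>\<close> from \<open>p0\<close> to the origin, Cauchy-Schwarz gives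
  \<open>M \<gamma> \<bullet> \<gamma>' \<le> F \<gamma> * norm \<gamma>'\<close>, and the left-hand side integrates to
  \<open>sin \<beta> * r p0 + cos \<beta> * (l1 + l2) * At\<close>, with \<open>At\<close> the value of \<^const>\<open>Atilde\<close> at the area of \<open>\<gamma>\<close>: up to the
  exact forms \<open>dr\<close> and \<open>d(p1 p2)\<close>, only the area form is left. So the energy is bounded below by a number
  that depends on the endpoints and the area alone, for every angle (\<open>calibration_inequality\<close>).

  Equality forces \<open>\<gamma>'\<close> to be a nonnegative multiple of \<open>M \<gamma>\<close> almost everywhere (\<open>calibration_equality\<close>), that is,
  \<open>\<gamma>\<close> runs along a solution of the linear system. Such a solution spirals into the origin, and after a
  change of time it becomes a Lipschitz curve \<open>c\<close> on the unit interval (\<open>spiral_curve\<close>). Its area is \<open>A\<close>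
  exactly when \<open>cot \<beta>\<close> has the prescribed value (\<open>solution_curve_area_energy\<close>). At this angle \<open>c\<close> attains the lower bound,
  so the minimizers are exactly the admissible curves with equality.

  For such a curve \<open>(r \<circ> \<gamma>)' = - sin \<beta> * F \<gamma> * norm \<gamma>' \<le> 0\<close>. This has three consequences. A minimizer cannot leave
  the origin once it is there, and before that it stays on the solution through \<open>p0\<close> (\<open>on_solution\<close>). The
  value of \<open>r\<close> serves as a common parameter, because it decreases strictly along \<open>c\<close>; this shows that all minimizers
  are monotone reparametrizations of \<open>c\<close> (\<open>monotone_reparam_of_common_trace\<close>). Finally \<open>F \<ge> sqrt (2 * min l1 l2 * r)\<close>,
  so the speed is at most a constant times the rate at which \<open>sqrt r\<close> decreases, and integration bounds
  the length by \<open>sqrt (2 * r p0 / min l1 l2) / sin \<beta>\<close> (\<open>arclength_le\<close>). Here \<open>1 / sin \<beta> \<le> 1 + \<bar>cot \<beta>\<bar>\<close>, and \<open>cot \<beta>\<close> is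
  controlled by \<open>A\<close>, \<open>r p0\<close> and the two parameters since \<open>\<bar>p1 p2\<bar> \<le> r p / sqrt (l1 * l2)\<close>.

  All curves are merely Lipschitz. The analytic basis is therefore that a Lipschitz function is differentiable
  almost everywhere and is the integral of its derivative (\<open>lipschitz_fundamental_theorem\<close>).
\<close>

section \<open>The fundamental theorem of calculus for Lipschitz functions\<close>

text \<open>
  Lebesgue's differentiation theorem for the gauge integral. A bad interval contributes to the error of
  a Riemann sum at least a fixed multiple of its length. By Henstock's lemma the total error of a fine family is small,
  hence so is the total length of any disjoint family of bad intervals; by Vitali's theorem such
  families cover almost all of the bad set.
\<close>

lemma ae_derivative_of_indefinite_integral:
  fixes h :: "real \<Rightarrow> real"
  assumes h: "h integrable_on {a..b}"
  obtains N where "negligible N"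
    "\<And>x. x \<in> {a..b} - N \<Longrightarrow>
       ((\<lambda>u. integral {a..u} h) has_vector_derivative h x) (at x within {a..b})"
proof -
  define bad where "bad n = {x. \<forall>d>0. \<exists>u v. u < v \<and> v - u < d \<and> (x = u \<or> x = v) \<and> a \<le> u \<and> v \<le> b \<and>
      v - u < real (Suc n) * norm ((v - u) * h x - integral {u..v} h)}" for n
  \<comment> \<open>\<open>bad n\<close> collects the points with arbitrarily short intervals, ending at the point, on which the mean of \<open>h\<close>
    misses the value \<open>h x\<close> by more than \<open>1 / (n + 1)\<close>; outside all of them the derivative exists.\<close>
  have neg: "negligible (bad n)" for n
    unfolding negligible_outer_le
  proof (intro allI impI)
    fix e :: real assume e: "e > 0"
    define e' where "e' = e / real (Suc n)"
    have e': "e' > 0" using e by (simp add: e'_def)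
    obtain g where g: "gauge g"
      and hen: "\<And>p. \<lbrakk>p tagged_partial_division_of (cbox a b); g fine p\<rbrakk> \<Longrightarrow>
             sum (\<lambda>(x,k). norm(measure lborel k *\<^sub>R h x - integral k h)) p < e'"
      using Henstock_lemma[of h a b e'] h e' by (auto simp: cbox_interval)
    define K where "K = {(x,u,v). u < v \<and> (x = u \<or> x = v) \<and> a \<le> u \<and> v \<le> b \<and> {u..v} \<subseteq> g x \<and>
      v - u < real (Suc n) * norm ((v - u) * h x - integral {u..v} h)}"
    define c :: "real \<times> real \<times> real \<Rightarrow> real" where "c = (\<lambda>(x,u,v). (u+v)/2)"
    define r :: "real \<times> real \<times> real \<Rightarrow> real" where "r = (\<lambda>(x,u,v). (v-u)/2)"
    have cb: "cball (c (x,u,v)) (r (x,u,v)) = {u..v}" for x u v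
      by (auto simp: c_def r_def cball_eq_atLeastAtMost field_simps)
    \<comment> \<open>The triples \<open>(x, u, v)\<close> of \<open>K\<close> are the bad intervals that are fine for the Henstock gauge; as closed
      balls they form a Vitali cover of \<open>bad n\<close>.\<close>
    obtain C where C: "countable C" "C \<subseteq> K"
     "pairwise (\<lambda>i j. disjnt (cball (c i) (r i)) (cball (c j) (r j))) C"
     "negligible(bad n - (\<Union>i \<in> C. cball (c i) (r i)))"
    proof (rule Vitali_covering_theorem_cballs[of K r "bad n" c])
      show "0 < r i" if "i \<in> K" for i using that by (auto simp: K_def r_def)
      fix x d :: real assume x: "x \<in> bad n" and d: "0 < d"
      obtain d' where d': "d' > 0" "ball x d' \<subseteq> g x"
        using g by (meson gauge_def open_contains_ball)
      obtain u v where uv: "u < v" "v - u < min d d'" "x = u \<or> x = v" "a \<le> u" "v \<le> b"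
        "v - u < real (Suc n) * norm ((v - u) * h x - integral {u..v} h)"
        using x d d'(1) unfolding bad_def mem_Collect_eq by (metis min_less_iff_conj)
      have "{u..v} \<subseteq> ball x d'" using uv by (auto simp: dist_real_def)
      then have "(x,u,v) \<in> K" using uv d' by (auto simp: K_def)
      moreover have "x \<in> cball (c (x,u,v)) (r (x,u,v))" using uv cb by auto
      moreover have "r (x,u,v) < d" using uv by (auto simp: r_def)
      ultimately show "\<exists>i. i \<in> K \<and> x \<in> cball (c i) (r i) \<and> r i < d" by blast
    qed
    let ?B = "\<lambda>i. cball (c i) (r i)"
    have fin: "(\<Sum>i\<in>I. measure lebesgue (?B i)) \<le> e" if I: "I \<subseteq> C" "finite I" for I
    proof -
      define tag where "tag = (\<lambda>(x,u,v::real). (x::real, {u..v::real}))"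
      have IK: "I \<subseteq> K" using I C by auto
      have dj: "fst (snd i) < snd (snd i)" if "i \<in> I" for i using that IK by (auto simp: K_def)
      have disj: "?B i \<inter> ?B j = {}" if "i \<in> I" "j \<in> I" "i \<noteq> j" for i j
        using C(3) I(1) that by (auto simp: pairwise_def disjnt_def)
      have inj: "inj_on tag I"
      proof (rule inj_onI, rule ccontr)
        fix i j assume ij: "i \<in> I" "j \<in> I" "tag i = tag j" "i \<noteq> j"
        obtain x u v x' u' v' where eq: "i = (x,u,v)" "j = (x',u',v')" by (metis surj_pair)
        have "?B i = ?B j" using ij(3) unfolding eq cb by (simp add: tag_def)
        moreover have "u \<in> ?B i" using dj[OF ij(1)] unfolding eq cb by simp
        ultimately show False using disj[OF ij(1,2,4)] by blast
      qed
      have tp: "(tag ` I) tagged_partial_division_of (cbox a b)"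
        unfolding tagged_partial_division_of_def
      proof (intro conjI allI impI)
        show "finite (tag ` I)" using I by simp
        fix x k assume "(x,k) \<in> tag ` I"
        then obtain u v where *: "(x,u,v) \<in> I" "k = {u..v}" by (auto simp: tag_def)
        then show "x \<in> k" "k \<subseteq> cbox a b" "\<exists>a b. k = cbox a b"
          using IK by (auto simp: K_def cbox_interval)
      next
        fix x k x' k' assume *: "(x,k) \<in> tag ` I \<and> (x',k') \<in> tag ` I \<and> (x,k) \<noteq> (x',k')"
        then obtain u v u' v' where i: "(x,u,v) \<in> I" "k = {u..v}" "(x',u',v') \<in> I" "k' = {u'..v'}"
          by (auto simp: tag_def)
        then have "(x,u,v) \<noteq> (x',u',v')" using * by auto
        from disj[OF i(1,3) this] have "k \<inter> k' = {}" using i by (simp add: cb)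
        then show "interior k \<inter> interior k' = {}" using interior_subset by blast
      qed
      let ?err = "\<lambda>i. case tag i of (x,k) \<Rightarrow> norm(measure lborel k *\<^sub>R h x - integral k h)"
      have "g fine (tag ` I)"
        using IK by (auto simp: fine_def tag_def K_def)
      from hen[OF tp this] have err: "(\<Sum>i\<in>I. ?err i) < e'"
        by (simp add: sum.reindex[OF inj] o_def)
      have "measure lebesgue (?B i) \<le> real (Suc n) * ?err i"
        if iI: "i \<in> I" for i
      proof -
        obtain x u v where eq: "i = (x,u,v)" by (metis surj_pair)
        have "(x,u,v) \<in> K" using iI IK eq by auto
        then show ?thesis unfolding eq cb by (auto simp: tag_def K_def)
      qed
      then have "(\<Sum>i\<in>I. measure lebesgue (?B i)) \<le> (\<Sum>i\<in>I. real (Suc n) * ?err i)"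
        by (rule sum_mono)
      also have "\<dots> = real (Suc n) * (\<Sum>i\<in>I. ?err i)"
        by (rule sum_distrib_left[symmetric])
      also have "\<dots> \<le> real (Suc n) * e'"
        using err by (intro mult_left_mono) auto
      finally have "(\<Sum>i\<in>I. measure lebesgue (?B i)) \<le> real (Suc n) * e'" .
      then show ?thesis by (simp add: e'_def)
    qed
    have fin': "measure lebesgue (\<Union>i\<in>I. ?B i) \<le> e" if I: "I \<subseteq> C" "finite I" for I
      by (rule order_trans[OF measure_UNION_le[OF I(2)] fin[OF I]]) (rule fmeasurableD[OF lmeasurable_cball])
    have U: "(\<Union>i\<in>C. ?B i) \<in> lmeasurable" "measure lebesgue (\<Union>i\<in>C. ?B i) \<le> e"
      using fmeasurable_UN_bound[OF C(1) lmeasurable_cball fin'] measure_UN_bound[OF C(1) lmeasurable_cball fin']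
      by auto
    let ?T = "(bad n - (\<Union>i\<in>C. ?B i)) \<union> (\<Union>i\<in>C. ?B i)"
    have "?T \<in> lmeasurable" using U C(4) negligible_imp_measurable by blast
    moreover have "measure lebesgue ?T \<le> e"
      using U(2) measure_Un_le[of "bad n - (\<Union>i\<in>C. ?B i)" lebesgue "\<Union>i\<in>C. ?B i"] negligible_imp_measure0[OF C(4)]
        fmeasurableD[OF U(1)] fmeasurableD[OF negligible_imp_measurable[OF C(4)]] by linarith
    ultimately show "\<exists>T. bad n \<subseteq> T \<and> T \<in> lmeasurable \<and> measure lebesgue T \<le> e"
      by (intro exI[of _ ?T] conjI) auto
  qed
  show ?thesis
  proof
    show "negligible (\<Union>n. bad n)" using neg by (intro negligible_Union_nat) auto
    fix x assume x: "x \<in> {a..b} - (\<Union>n. bad n)"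
    show "((\<lambda>u. integral {a..u} h) has_vector_derivative h x) (at x within {a..b})"
      unfolding has_vector_derivative_def has_derivative_within_alt
    proof (intro conjI allI impI)
      show "bounded_linear (\<lambda>xa. xa *\<^sub>R h x)" by (rule bounded_linear_scaleR_left)
      fix e :: real assume e: "e > 0"
      obtain n where n: "1 / real (Suc n) < e" using nat_approx_posE[OF e] by auto
      from x have "x \<notin> bad n" by auto
      then obtain d where d: "d > 0" "\<And>u v. u < v \<Longrightarrow> v - u < d \<Longrightarrow> x = u \<or> x = v \<Longrightarrow> a \<le> u \<Longrightarrow> v \<le> b \<Longrightarrow>
        real (Suc n) * norm ((v - u) * h x - integral {u..v} h) \<le> v - u"
        unfolding bad_def mem_Collect_eq by (meson linorder_not_le)
      have d': "norm ((v - u) * h x - integral {u..v} h) \<le> e * (v - u)"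
        if "u < v" "v - u < d" "x = u \<or> x = v" "a \<le> u" "v \<le> b" for u v
      proof -
        have "norm ((v - u) * h x - integral {u..v} h) \<le> 1 / real (Suc n) * (v - u)"
          using d(2)[OF that] by (simp add: field_simps)
        also have "\<dots> \<le> e * (v - u)" using n that by (intro mult_right_mono) auto
        finally show ?thesis .
      qed
      show "\<exists>d>0. \<forall>y\<in>{a..b}. norm (y - x) < d \<longrightarrow>
        norm (integral {a..y} h - integral {a..x} h - (y - x) *\<^sub>R h x) \<le> e * norm (y - x)"
      proof (intro exI[of _ d] conjI ballI impI d)
        fix y assume y: "y \<in> {a..b}" "norm (y - x) < d"
        have comb: "integral {a..v} h = integral {a..u} h + integral {u..v} h" if "a \<le> u" "u \<le> v" "v \<le> b" for u v
          using Henstock_Kurzweil_Integration.integral_combine[of a u v h] integrable_on_subinterval[OF h, of a v] that by auto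
        consider "x < y" | "y < x" | "x = y" by linarith
        then show "norm (integral {a..y} h - integral {a..x} h - (y - x) *\<^sub>R h x) \<le> e * norm (y - x)"
        proof cases
          case 1
          then show ?thesis using d'[of x y] comb[of x y] x y by (auto simp: abs_minus_commute)
        next
          case 2
          then have "norm ((x - y) * h x - integral {y..x} h) \<le> e * (x - y)" using d'[of y x] x y by auto
          then show ?thesis using 2 comb[of y x] x y by (auto simp: algebra_simps)
        qed simp
      qed
    qed
  qed
qed

text \<open>
  The density \<open>h\<close> is a Radon-Nikodym derivative: a function that is bi-Lipschitz and increasing transports
  Lebesgue measure to a measure with the same null sets.
\<close>

lemma lipschitz_is_indefinite_integral:
  fixes f :: "real \<Rightarrow> real"
  assumes f: "L-lipschitz_on {a..b} f" and ab: "a \<le> b"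
  obtains h where "\<And>x. x \<in> {a..b} \<Longrightarrow> (h has_integral (f x - f a)) {a..x}"
proof -
  \<comment> \<open>The clamped extension of \<open>f\<close> plus a slope of \<open>L + 1\<close>: all difference quotients of \<open>F\<close> lie between
    \<open>1\<close> and \<open>2 * L + 1\<close>, so \<open>F\<close> is a bi-Lipschitz bijection of the line.\<close>
  define F where "F x = f (max a (min b x)) + (L + 1) * x" for x
  have L: "L \<ge> 0" using f by (simp add: lipschitz_on_def)
  have cl: "\<bar>f (max a (min b x)) - f (max a (min b y))\<bar> \<le> L * \<bar>x - y\<bar>" for x y
  proof -
    have "\<bar>f (max a (min b x)) - f (max a (min b y))\<bar> \<le> L * \<bar>max a (min b x) - max a (min b y)\<bar>"
      using lipschitz_onD[OF f, of "max a (min b x)" "max a (min b y)"] ab by (auto simp: dist_real_def)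
    also have "\<dots> \<le> L * \<bar>x - y\<bar>" using L by (intro mult_left_mono) auto
    finally show ?thesis .
  qed
  have Fexp: "F y - F x \<ge> y - x" if "x \<le> y" for x y
  proof -
    have "F y - F x = (f (max a (min b y)) - f (max a (min b x))) + L * \<bar>x - y\<bar> + (y - x)"
      using that by (simp add: F_def algebra_simps)
    then show ?thesis using cl[of x y] by linarith
  qed
  have Flip: "norm (F y - F x) \<le> (2 * L + 1) * norm (y - x)" for x y
  proof -
    have "F y - F x = (f (max a (min b y)) - f (max a (min b x))) + (L + 1) * (y - x)"
      by (simp add: F_def algebra_simps)
    then have "\<bar>F y - F x\<bar> \<le> \<bar>f (max a (min b y)) - f (max a (min b x))\<bar> + \<bar>(L + 1) * (y - x)\<bar>"
      by (metis abs_triangle_ineq)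
    moreover have "\<bar>(L + 1) * (y - x)\<bar> = (L + 1) * \<bar>y - x\<bar>"
      using L by (simp add: abs_mult)
    ultimately have "\<bar>F y - F x\<bar> \<le> L * \<bar>y - x\<bar> + (L + 1) * \<bar>y - x\<bar>"
      using cl[of y x] by linarith
    then show ?thesis by (simp add: algebra_simps)
  qed
  have Fcont: "continuous_on S F" for S
    by (rule lipschitz_on_continuous_on[of "2*L+1"], rule lipschitz_onI)
       (use Flip L in \<open>auto simp: dist_norm\<close>)
  have Fless: "F x < F y \<longleftrightarrow> x < y" for x y
    using Fexp[of x y] Fexp[of y x] by (cases "x < y") auto
  have Fle: "F x \<le> F y \<longleftrightarrow> x \<le> y" for x y
    using Fless[of y x] by auto
  have "inj F" by (rule injI) (metis Fless linorder_neqE_linordered_idom order_less_irrefl)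
  have "surj F"
  proof (unfold surj_def, rule allI)
    fix y
    define d where "d = \<bar>y - F 0\<bar>"
    have "F (-d) \<le> y" "y \<le> F d" using Fexp[of "-d" 0] Fexp[of 0 d] by (auto simp: d_def)
    then show "\<exists>x. y = F x" using IVT'[of F "-d" y d] Fcont by (force simp: d_def)
  qed
  define g where "g = inv F"
  have gF: "g (F x) = x" for x using \<open>inj F\<close> by (simp add: g_def)
  have Fg: "F (g y) = y" for y using \<open>surj F\<close> by (simp add: g_def surj_f_inv_f)
  have "mono g" by (rule monoI) (metis Fg Fle)
  then have [measurable]: "g \<in> borel_measurable borel" by (rule borel_measurable_mono)
  define N where "N = distr lborel borel g"
  have [simp]: "sets N = sets borel" by (simp add: N_def)
  \<comment> \<open>\<open>N A\<close> is the measure of \<open>F ` A\<close>, and Lipschitz images of null sets are null.\<close>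
  have ac: "absolutely_continuous lborel N"
    unfolding absolutely_continuous_def
  proof
    fix A :: "real set" assume A: "A \<in> null_sets lborel"
    then have [measurable]: "A \<in> sets borel" by auto
    have "negligible A" using A
      by (simp add: negligible_iff_null_sets null_sets_completionI)
    then have "negligible (F ` A)"
      by (rule negligible_locally_Lipschitz_image[rotated]) (use Flip in \<open>auto intro!: exI[of _ UNIV] exI[of _ "2*L+1"]\<close>)
    moreover have "g -` A = F ` A"
    proof (intro set_eqI iffI)
      fix z assume "z \<in> g -` A"
      then show "z \<in> F ` A" using Fg[of z] by (intro image_eqI[of _ _ "g z"]) auto
    qed (auto simp: gF)
    ultimately have "g -` A \<in> null_sets lebesgue" by (simp add: negligible_iff_null_sets)
    moreover have "g -` A \<in> sets borel" using measurable_sets[of g borel borel A] by simp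
    ultimately have "g -` A \<in> null_sets lborel" by (simp add: null_sets_completion_iff)
    then show "A \<in> null_sets N" by (simp add: N_def null_sets_def emeasure_distr)
  qed
  have emN: "emeasure N {x..y} = ennreal (F y - F x)" if "x \<le> y" for x y
  proof -
    have "x \<le> g z \<and> g z \<le> y \<longleftrightarrow> F x \<le> z \<and> z \<le> F y" for z
      using Fle[of x "g z"] Fle[of "g z" y] by (simp add: Fg)
    then have "g -` {x..y} = {F x..F y}" by auto
    then show ?thesis using Fle[of x y] that by (simp add: N_def emeasure_distr)
  qed
  obtain d where d[measurable]: "d \<in> borel_measurable lborel" and dN: "density lborel d = N"
    using sigma_finite_measure.Radon_Nikodym[OF sigma_finite_lborel ac] by auto
  have int: "((\<lambda>t. enn2real (d t)) has_integral (F y - F x)) {x..y}" if xy: "x \<le> y" for x y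
  proof -
    have *: "(\<integral>\<^sup>+t. d t * indicator {x..y} t \<partial>lborel) = ennreal (F y - F x)"
      using emN[OF xy] emeasure_density[OF d, of "{x..y}"] dN by simp
    then have "AE t in lborel. d t * indicator {x..y} t \<noteq> \<infinity>"
      by (intro nn_integral_PInf_AE) auto
    then have "(\<integral>\<^sup>+t. ennreal (enn2real (d t) * indicator {x..y} t) \<partial>lborel) = (\<integral>\<^sup>+t. d t * indicator {x..y} t \<partial>lborel)"
    proof (intro nn_integral_cong_AE, elim eventually_mono)
      fix t assume "d t * indicator {x..y} t \<noteq> \<infinity>"
      then show "ennreal (enn2real (d t) * indicator {x..y} t) = d t * indicator {x..y} t"
        by (cases "t \<in> {x..y}") (simp_all add: less_top[symmetric])
    qed
    then have "((\<lambda>t. enn2real (d t) * indicator {x..y} t) has_integral (F y - F x)) UNIV"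
      using * Fle xy by (intro nn_integral_has_integral) auto
    moreover have "(\<lambda>t. enn2real (d t) * indicator {x..y} t) = (\<lambda>t. if t \<in> {x..y} then enn2real (d t) else 0)"
      by (auto simp: indicator_def)
    ultimately show ?thesis using has_integral_restrict_UNIV[of "{x..y}"] by metis
  qed
  show ?thesis
  proof
    fix x assume x: "x \<in> {a..b}"
    have "((\<lambda>t. enn2real (d t) - (L + 1)) has_integral ((F x - F a) - (L + 1) * (x - a))) {a..x}"
      using has_integral_diff[OF int[of a x] has_integral_const_real[of "L+1" a x]] x
      by (simp add: mult.commute)
    moreover have "(F x - F a) - (L + 1) * (x - a) = f x - f a"
      using x by (simp add: F_def algebra_simps)
    ultimately show "((\<lambda>t. enn2real (d t) - (L + 1)) has_integral (f x - f a)) {a..x}" by simp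
  qed
qed

lemma lipschitz_fundamental_theorem_real:
  fixes f :: "real \<Rightarrow> real"
  assumes f: "L-lipschitz_on {a..b} f" and ab: "a \<le> b"
  obtains h N where "negligible N"
    "\<And>x. x \<in> {a..b} - N \<Longrightarrow> (f has_vector_derivative h x) (at x within {a..b})"
    "(h has_integral (f b - f a)) {a..b}"
proof -
  obtain h where h: "\<And>x. x \<in> {a..b} \<Longrightarrow> (h has_integral (f x - f a)) {a..x}"
    using lipschitz_is_indefinite_integral[OF f ab] by blast
  have hb: "(h has_integral (f b - f a)) {a..b}" using h[of b] ab by simp
  then have "h integrable_on {a..b}" by blast
  then obtain N where N: "negligible N"
    "\<And>x. x \<in> {a..b} - N \<Longrightarrow>
       ((\<lambda>u. integral {a..u} h) has_vector_derivative h x) (at x within {a..b})"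
    using ae_derivative_of_indefinite_integral by blast
  have "(f has_vector_derivative h x) (at x within {a..b})" if x: "x \<in> {a..b} - N" for x
  proof -
    have "((\<lambda>u. f a + integral {a..u} h) has_vector_derivative h x) (at x within {a..b})"
      using has_vector_derivative_add[OF has_vector_derivative_const N(2)[OF x]] by simp
    then show ?thesis
      by (rule has_vector_derivative_transform[rotated 2]) (use x h[THEN integral_unique] in auto)
  qed
  then show ?thesis using that N(1) hb by blast
qed

lemma lipschitz_fundamental_theorem:
  fixes f :: "real \<Rightarrow> 'a::euclidean_space"
  assumes f: "L-lipschitz_on {a..b} f" and ab: "a \<le> b"
  obtains h N where "negligible N"
    "\<And>x. x \<in> {a..b} - N \<Longrightarrow> (f has_vector_derivative h x) (at x within {a..b})"
    "(h has_integral (f b - f a)) {a..b}"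
proof -
  have "\<exists>h N. negligible N \<and>
    (\<forall>x. x \<in> {a..b} - N \<longrightarrow> ((\<lambda>t. f t \<bullet> i) has_vector_derivative h x) (at x within {a..b})) \<and>
    (h has_integral (f b \<bullet> i - f a \<bullet> i)) {a..b}" if i: "i \<in> Basis" for i
  proof -
    have "L-lipschitz_on {a..b} (\<lambda>t. f t \<bullet> i)"
    proof (rule lipschitz_onI)
      fix x y assume "x \<in> {a..b}" "y \<in> {a..b}"
      then have "dist (f x) (f y) \<le> L * dist x y" by (rule lipschitz_onD[OF f])
      then show "dist (f x \<bullet> i) (f y \<bullet> i) \<le> L * dist x y"
        using Basis_le_norm[OF i, of "f x - f y"] by (auto simp: dist_norm inner_diff_left)
    qed (use f in \<open>auto simp: lipschitz_on_def\<close>)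
    from lipschitz_fundamental_theorem_real[OF this ab] show ?thesis by metis
  qed
  then obtain h N where hN: "\<And>i. i \<in> Basis \<Longrightarrow> negligible (N i)"
    "\<And>i x. i \<in> Basis \<Longrightarrow> x \<in> {a..b} - N i \<Longrightarrow> ((\<lambda>t. f t \<bullet> i) has_vector_derivative h i x) (at x within {a..b})"
    "\<And>i. i \<in> Basis \<Longrightarrow> (h i has_integral (f b \<bullet> i - f a \<bullet> i)) {a..b}"
    by metis
  show ?thesis
  proof
    show "negligible (\<Union>i\<in>Basis. N i)" using hN(1) by (intro negligible_Union) auto
    show "(f has_vector_derivative (\<Sum>i\<in>Basis. h i x *\<^sub>R i)) (at x within {a..b})"
      if x: "x \<in> {a..b} - (\<Union>i\<in>Basis. N i)" for x
    proof -
      have "((\<lambda>t. \<Sum>i\<in>Basis. (f t \<bullet> i) *\<^sub>R i) has_vector_derivative (\<Sum>i\<in>Basis. h i x *\<^sub>R i)) (at x within {a..b})"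
        by (intro has_vector_derivative_sum bounded_linear.has_vector_derivative[OF bounded_linear_scaleR_left]) (use hN(2) x in auto)
      then show ?thesis by (simp add: euclidean_representation)
    qed
    show "((\<lambda>x. \<Sum>i\<in>Basis. h i x *\<^sub>R i) has_integral f b - f a) {a..b}"
    proof -
      have "((\<lambda>x. \<Sum>i\<in>Basis. h i x *\<^sub>R i) has_integral (\<Sum>i\<in>Basis. (f b \<bullet> i - f a \<bullet> i) *\<^sub>R i)) {a..b}"
        by (intro has_integral_sum has_integral_scaleR_left) (use hN(3) in auto)
      then show ?thesis by (simp add: euclidean_representation flip: inner_diff_left)
    qed
  qed
qed

lemma lipschitz_ae_has_vector_derivative:
  fixes f :: "real \<Rightarrow> 'a::euclidean_space"
  assumes f: "L-lipschitz_on {a..b} f" and ab: "a < b"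
  obtains N where "negligible N"
    "\<And>x. x \<in> {a..b} - N \<Longrightarrow>
       (f has_vector_derivative vector_derivative f (at x within {a..b})) (at x within {a..b})"
proof -
  obtain h N where N: "negligible N"
    "\<And>x. x \<in> {a..b} - N \<Longrightarrow> (f has_vector_derivative h x) (at x within {a..b})"
    by (rule lipschitz_fundamental_theorem[OF f less_imp_le[OF ab]]) (rule that)
  show ?thesis
    by (rule that[OF N(1)], rule vector_derivative_works[THEN iffD1], rule differentiableI_vector, rule N(2))
qed

text \<open>
  The form in which the theorem is applied: the derivative may be computed by any rule of calculus, at
  almost every point.
\<close>

lemma lipschitz_has_integral_ae_derivative:
  fixes f :: "real \<Rightarrow> 'a::euclidean_space"
  assumes f: "L-lipschitz_on {a..b} f" and ab: "a \<le> b" and N: "negligible N"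
    and f': "\<And>x. x \<in> {a..b} - N \<Longrightarrow> (f has_vector_derivative f' x) (at x within {a..b})"
  shows "(f' has_integral (f b - f a)) {a..b}"
proof (cases "a = b")
  case False
  with ab have ab': "a < b" by simp
  obtain h M where hM: "negligible M"
    "\<And>x. x \<in> {a..b} - M \<Longrightarrow> (f has_vector_derivative h x) (at x within {a..b})"
    "(h has_integral (f b - f a)) {a..b}"
    by (rule lipschitz_fundamental_theorem[OF f ab]) (rule that)
  show ?thesis
  proof (rule has_integral_spike[OF _ _ hM(3)])
    show "negligible (N \<union> M)" using N hM(1) by (rule negligible_Un)
    fix x assume "x \<in> {a..b} - (N \<union> M)"
    then show "f' x = h x"
      using vector_derivative_unique_within_closed_interval[of a b x f "f' x" "h x"] f' hM(2) ab' by auto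
  qed
qed auto

lemma has_integral_mono_ae:
  fixes f :: "'a::euclidean_space \<Rightarrow> real"
  assumes f: "(f has_integral i) S" and g: "(g has_integral j) S" and M: "negligible M"
    and le: "\<And>x. x \<in> S - M \<Longrightarrow> f x \<le> g x"
  shows "i \<le> j"
proof -
  have "((\<lambda>x. if x \<in> M then f x else g x) has_integral j) S"
    by (rule has_integral_spike[OF M _ g]) auto
  then show ?thesis by (rule has_integral_le[OF f]) (use le in auto)
qed

text \<open>
  The indefinite integral of \<open>h\<close> is monotone with equal end values, thus constant, and \<open>h\<close> is almost everywhere
  its derivative.
\<close>

lemma nonneg_has_integral_0_imp_ae_0:
  fixes h :: "real \<Rightarrow> real"
  assumes h: "(h has_integral 0) {a..b}" and ab: "a < b" and M: "negligible M"
    and nonneg: "\<And>x. x \<in> {a..b} - M \<Longrightarrow> h x \<ge> 0"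
  obtains N where "negligible N" "\<And>x. x \<in> {a..b} - N \<Longrightarrow> h x = 0"
proof -
  have hi: "h integrable_on {a..b}" using h by blast
  obtain N where N: "negligible N"
    "\<And>x. x \<in> {a..b} - N \<Longrightarrow>
       ((\<lambda>u. integral {a..u} h) has_vector_derivative h x) (at x within {a..b})"
    by (rule ae_derivative_of_indefinite_integral[OF hi]) (rule that)
  have nn: "integral {c..d} h \<ge> 0" if "a \<le> c" "d \<le> b" for c d
  proof -
    have "h integrable_on {c..d}" using that integrable_on_subinterval[OF hi, of c d] by auto
    then show ?thesis
      by (rule has_integral_mono_ae[OF has_integral_0 integrable_integral M]) (use nonneg that in auto)
  qed
  have zero: "integral {a..x} h = 0" if "x \<in> {a..b}" for x
    using nn[of a x] nn[of x b] Henstock_Kurzweil_Integration.integral_combine[of a x b h] hi that integral_unique[OF h]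
    by simp
  have "h x = 0" if x: "x \<in> {a..b} - N" for x
  proof -
    have "((\<lambda>u. 0) has_vector_derivative h x) (at x within {a..b})"
      by (rule has_vector_derivative_transform[rotated 2, OF N(2)[OF x]]) (use x zero in auto)
    then show ?thesis
      using vector_derivative_unique_within_closed_interval[of a b x "\<lambda>u. 0" "h x" 0] x ab by auto
  qed
  then show ?thesis using that N(1) by blast
qed

lemma lipschitz_ae_nonpos_derivative_imp_antimono:
  fixes f :: "real \<Rightarrow> real"
  assumes f: "L-lipschitz_on {a..b} f" and N: "negligible N"
    and d: "\<And>t. t \<in> {a..b} - N \<Longrightarrow> (f has_real_derivative f' t) (at t within {a..b})"
    and le: "\<And>t. t \<in> {a..b} - N \<Longrightarrow> f' t \<le> 0"
    and st: "a \<le> s" "s \<le> t" "t \<le> b"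
  shows "f t \<le> f s"
proof -
  have "(f' has_integral (f t - f s)) {s..t}"
  proof (rule lipschitz_has_integral_ae_derivative[OF _ st(2) N])
    show "L-lipschitz_on {s..t} f" by (rule lipschitz_on_subset[OF f]) (use st in auto)
    show "(f has_vector_derivative f' u) (at u within {s..t})" if "u \<in> {s..t} - N" for u
      using d[of u] that st unfolding has_real_derivative_iff_has_vector_derivative
      by (auto intro: has_vector_derivative_within_subset)
  qed
  then have "f t - f s \<le> 0"
    by (rule has_integral_mono_ae[OF _ has_integral_0 N]) (use le st in auto)
  then show ?thesis by simp
qed

section \<open>The quadratic form, the weight and the linear system\<close>

lemma inner_real2: "x \<bullet> y = x$1 * y$1 + x$2 * y$2" for x y :: "real^2"
  by (simp add: inner_vec_def sum_2)

lemma has_real_derivative_vec_nth: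
  fixes \<gamma> :: "real \<Rightarrow> real^'n"
  assumes "(\<gamma> has_vector_derivative v) (at t within S)"
  shows "((\<lambda>s. \<gamma> s $ i) has_real_derivative v $ i) (at t within S)"
  unfolding has_real_derivative_iff_has_vector_derivative
  by (rule bounded_linear.has_vector_derivative[OF bounded_linear_vec_nth assms])

lemma system_matrix_apply:
  "(system_matrix l1 l2 \<beta> *v p) $ 1 = - l1 * sin \<beta> * p$1 - l2 * cos \<beta> * p$2"
  "(system_matrix l1 l2 \<beta> *v p) $ 2 = l1 * cos \<beta> * p$1 - l2 * sin \<beta> * p$2"
  by (simp_all add: system_matrix_def matrix_vector_mult_def sum_2)

lemma norm_system_matrix: "norm (system_matrix l1 l2 \<beta> *v p) = weight l1 l2 p"
proof -
  let ?q = "system_matrix l1 l2 \<beta> *v p"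
  have "?q \<bullet> ?q = (l1\<^sup>2 * (p$1)\<^sup>2 + l2\<^sup>2 * (p$2)\<^sup>2) * ((sin \<beta>)\<^sup>2 + (cos \<beta>)\<^sup>2)"
    unfolding inner_real2 system_matrix_apply by algebra
  then show ?thesis by (simp add: norm_eq_sqrt_inner weight_def)
qed

lemma weight_nonneg: "weight l1 l2 p \<ge> 0"
  by (simp add: weight_def)

lemma weight_squared: "(weight l1 l2 p)\<^sup>2 = l1\<^sup>2 * (p$1)\<^sup>2 + l2\<^sup>2 * (p$2)\<^sup>2"
  by (simp add: weight_def)

text \<open>
  The rate of change of the quadratic form along the linear system. Its sign is what makes the form a Lyapunov function.
\<close>

lemma gradient_inner_system:
  "l1 * p$1 * (system_matrix l1 l2 \<beta> *v p) $ 1 + l2 * p$2 * (system_matrix l1 l2 \<beta> *v p) $ 2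
     = - sin \<beta> * (weight l1 l2 p)\<^sup>2"
  unfolding system_matrix_apply weight_squared by algebra

lemma has_real_derivative_rtilde:
  assumes "(\<gamma> has_vector_derivative v) (at t within S)"
  shows "((\<lambda>s. rtilde l1 l2 (\<gamma> s)) has_real_derivative (l1 * \<gamma> t $ 1 * v $ 1 + l2 * \<gamma> t $ 2 * v $ 2)) (at t within S)"
  unfolding rtilde_def
  by (rule derivative_eq_intros has_real_derivative_vec_nth[OF assms] refl | simp)+

lemma continuous_rtilde: "continuous_on S (rtilde l1 l2)"
  unfolding rtilde_def by (intro continuous_intros) auto

lemma rtilde_0 [simp]: "rtilde l1 l2 0 = 0"
  by (simp add: rtilde_def)

lemma continuous_weight: "continuous_on S (weight l1 l2)"
  unfolding weight_def by (intro continuous_intros)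

context
  fixes l1 l2 :: real
  assumes l1: "l1 > 0" and l2: "l2 > 0"
begin

lemma rtilde_nonneg: "rtilde l1 l2 p \<ge> 0"
  using l1 l2 by (simp add: rtilde_def)

lemma rtilde_eq_0_iff: "rtilde l1 l2 p = 0 \<longleftrightarrow> p = 0"
  using l1 l2 by (auto simp: rtilde_def vec_eq_iff forall_2 add_nonneg_eq_0_iff)

lemma rtilde_pos_iff: "rtilde l1 l2 p > 0 \<longleftrightarrow> p \<noteq> 0"
  using rtilde_nonneg[of p] rtilde_eq_0_iff[of p] by linarith

lemma weight_squared_ge: "2 * min l1 l2 * rtilde l1 l2 p \<le> (weight l1 l2 p)\<^sup>2"
proof -
  have "min l1 l2 * l1 * (p$1)\<^sup>2 \<le> l1 * l1 * (p$1)\<^sup>2" "min l1 l2 * l2 * (p$2)\<^sup>2 \<le> l2 * l2 * (p$2)\<^sup>2"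
    using l1 l2 by (intro mult_right_mono; simp)+
  then show ?thesis unfolding weight_squared rtilde_def by (simp add: algebra_simps power2_eq_square)
qed

lemma weight_squared_le: "(weight l1 l2 p)\<^sup>2 \<le> 2 * max l1 l2 * rtilde l1 l2 p"
proof -
  have "max l1 l2 * l1 * (p$1)\<^sup>2 \<ge> l1 * l1 * (p$1)\<^sup>2" "max l1 l2 * l2 * (p$2)\<^sup>2 \<ge> l2 * l2 * (p$2)\<^sup>2"
    using l1 l2 by (intro mult_right_mono; simp)+
  then show ?thesis unfolding weight_squared rtilde_def by (simp add: algebra_simps power2_eq_square)
qed

lemma weight_eq_0_iff: "weight l1 l2 p = 0 \<longleftrightarrow> p = 0"
  using l1 l2 by (auto simp: weight_def vec_eq_iff forall_2 add_nonneg_eq_0_iff)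

lemma norm_squared_le_rtilde: "min l1 l2 * (norm p)\<^sup>2 \<le> 2 * rtilde l1 l2 p"
proof -
  have "min l1 l2 * (p$1)\<^sup>2 \<le> l1 * (p$1)\<^sup>2" "min l1 l2 * (p$2)\<^sup>2 \<le> l2 * (p$2)\<^sup>2"
    by (intro mult_right_mono; simp)+
  then show ?thesis unfolding rtilde_def power2_norm_eq_inner inner_real2
    by (simp add: algebra_simps power2_eq_square)
qed

end

section \<open>Solutions of the linear system\<close>

text \<open>
  The entire functions \<open>cosh (sqrt d * t)\<close> and \<open>sinh (sqrt d * t) / sqrt d\<close>, in real form
  for either sign of \<open>d\<close> and as their limits for \<open>d = 0\<close>.
\<close>

lemma oscillator_solution:
  fixes d :: real
  obtains C S :: "real \<Rightarrow> real" where "C 0 = 1" "S 0 = 0"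
    "\<And>t. (C has_real_derivative d * S t) (at t)" "\<And>t. (S has_real_derivative C t) (at t)"
proof -
  consider "d = 0" | "d > 0" | "d < 0" by linarith
  then show thesis
  proof cases
    case 1
    show thesis
      by (rule that[of "\<lambda>t. 1" "\<lambda>t. t"]) (auto simp: 1)
  next
    case 2
    define k where "k = sqrt d"
    have k: "k > 0" "d = k * k" using 2 by (auto simp: k_def)
    show thesis
      by (rule that[of "\<lambda>t. cosh (k * t)" "\<lambda>t. sinh (k * t) / k"])
         (use k in \<open>auto intro!: derivative_eq_intros simp: field_simps\<close>)
  next
    case 3
    define k where "k = sqrt (- d)"
    have k: "k > 0" "- d = k * k" using 3 by (auto simp: k_def)
    then have d: "d = - (k * k)" by simp
    show thesis
      by (rule that[of "\<lambda>t. cos (k * t)" "\<lambda>t. sin (k * t) / k"])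
         (use k(1) d in \<open>auto intro!: derivative_eq_intros simp: field_simps\<close>)
  qed
qed

text \<open>
  A traceless two-by-two matrix has a scalar square, so that its exponential is a combination of the identity
  and the matrix itself. The trace contributes the factor \<open>exp (\<tau> * t)\<close>.
\<close>

lemma planar_linear_ode_solution:
  fixes A :: "real^2^2"
  obtains x :: "real \<Rightarrow> real^2" where "x 0 = p0" "\<And>t. (x has_vector_derivative A *v x t) (at t)"
proof -
  define \<tau> where "\<tau> = (A$1$1 + A$2$2) / 2"
  define \<delta> where "\<delta> = ((A$1$1 - A$2$2) / 2)\<^sup>2 + A$1$2 * A$2$1"
  define q where "q = A *v p0 - \<tau> *\<^sub>R p0"
  \<comment> \<open>Cayley-Hamilton for the traceless part \<open>B = A - \<tau>\<close>, which satisfies \<open>B\<^sup>2 = \<delta>\<close>.\<close>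
  have Aq: "A *v q = \<tau> *\<^sub>R q + \<delta> *\<^sub>R p0"
    unfolding q_def \<tau>_def \<delta>_def vec_eq_iff forall_2
    by (simp add: matrix_vector_mult_def sum_2 field_simps power2_eq_square)
  have Ap: "A *v p0 = \<tau> *\<^sub>R p0 + q" by (simp add: q_def)
  obtain C S where CS: "C 0 = 1" "S 0 = 0"
    "\<And>t. (C has_real_derivative \<delta> * S t) (at t)" "\<And>t. (S has_real_derivative C t) (at t)"
    using oscillator_solution[of \<delta>] by blast
  define x where "x t = (exp (\<tau> * t) * C t) *\<^sub>R p0 + (exp (\<tau> * t) * S t) *\<^sub>R q" for t
  show thesis
  proof
    show "x 0 = p0" by (simp add: x_def CS)
    fix t
    have 1: "((\<lambda>t. exp (\<tau> * t) * C t) has_vector_derivative (\<tau> * (exp (\<tau> * t) * C t) + \<delta> * (exp (\<tau> * t) * S t))) (at t)"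
      and 2: "((\<lambda>t. exp (\<tau> * t) * S t) has_vector_derivative (\<tau> * (exp (\<tau> * t) * S t) + exp (\<tau> * t) * C t)) (at t)"
      unfolding has_real_derivative_iff_has_vector_derivative[symmetric]
      by (rule derivative_eq_intros CS refl | simp add: algebra_simps)+
    have "(x has_vector_derivative ((\<tau> * (exp (\<tau> * t) * C t) + \<delta> * (exp (\<tau> * t) * S t)) *\<^sub>R p0
        + (\<tau> * (exp (\<tau> * t) * S t) + exp (\<tau> * t) * C t) *\<^sub>R q)) (at t)"
      unfolding x_def
      by (intro has_vector_derivative_add bounded_linear.has_vector_derivative[OF bounded_linear_scaleR_left] 1 2)
    also have "(\<tau> * (exp (\<tau> * t) * C t) + \<delta> * (exp (\<tau> * t) * S t)) *\<^sub>R p0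
        + (\<tau> * (exp (\<tau> * t) * S t) + exp (\<tau> * t) * C t) *\<^sub>R q = A *v x t"
      by (simp add: x_def matrix_vector_right_distrib matrix_vector_mult_scaleR Ap Aq algebra_simps)
    finally show "(x has_vector_derivative A *v x t) (at t)" .
  qed
qed

context
  fixes l1 l2 \<beta> :: real
  assumes l1: "l1 > 0" and l2: "l2 > 0" and beta: "0 < \<beta>" "\<beta> < pi"
begin

text \<open>
  The squared weight lies between two multiples of the quadratic form, so the form decays exponentially, at a rate
  bounded from both sides.
\<close>

lemma rtilde_solution_bounds:
  assumes x: "\<And>t. (x has_vector_derivative system_matrix l1 l2 \<beta> *v x t) (at t)" and t: "t \<ge> 0"
  shows "rtilde l1 l2 (x t) \<le> rtilde l1 l2 (x 0) * exp (- 2 * min l1 l2 * sin \<beta> * t)"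
    and "rtilde l1 l2 (x t) \<ge> rtilde l1 l2 (x 0) * exp (- 2 * max l1 l2 * sin \<beta> * t)"
proof -
  have s: "sin \<beta> > 0" using beta by (rule sin_gt_zero)
  let ?d = "\<lambda>c t. exp (2 * c * sin \<beta> * t) * sin \<beta> * (2 * c * rtilde l1 l2 (x t) - (weight l1 l2 (x t))\<^sup>2)"
  have d: "((\<lambda>t. rtilde l1 l2 (x t) * exp (2 * c * sin \<beta> * t)) has_real_derivative ?d c t) (at t)" for c t
    by (rule derivative_eq_intros has_real_derivative_rtilde[OF x] refl
        | simp only: gradient_inner_system | simp add: algebra_simps)+
  have "rtilde l1 l2 (x t) * exp (2 * min l1 l2 * sin \<beta> * t) \<le> rtilde l1 l2 (x 0) * exp (2 * min l1 l2 * sin \<beta> * 0)"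
  proof (rule DERIV_nonpos_imp_nonincreasing[OF t], intro exI conjI)
    fix u show "?d (min l1 l2) u \<le> 0"
      using s weight_squared_ge[OF l1 l2, of "x u"] by (intro mult_nonneg_nonpos) auto
  qed (rule d)
  then show "rtilde l1 l2 (x t) \<le> rtilde l1 l2 (x 0) * exp (- 2 * min l1 l2 * sin \<beta> * t)"
    by (simp add: exp_minus field_simps)
  have "rtilde l1 l2 (x t) * exp (2 * max l1 l2 * sin \<beta> * t) \<ge> rtilde l1 l2 (x 0) * exp (2 * max l1 l2 * sin \<beta> * 0)"
  proof (rule DERIV_nonneg_imp_nondecreasing[OF t], intro exI conjI)
    fix u show "?d (max l1 l2) u \<ge> 0"
      using s weight_squared_le[OF l1 l2, of "x u"] by (intro mult_nonneg_nonneg) auto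
  qed (rule d)
  then show "rtilde l1 l2 (x t) \<ge> rtilde l1 l2 (x 0) * exp (- 2 * max l1 l2 * sin \<beta> * t)"
    by (simp add: exp_minus field_simps)
qed

lemma spiral_solution:
  assumes p0: "p0 \<noteq> 0"
  obtains x where "x 0 = p0" "\<And>t. (x has_vector_derivative system_matrix l1 l2 \<beta> *v x t) (at t)"
    "\<And>t. t \<ge> 0 \<Longrightarrow> x t \<noteq> 0"
    "\<And>t. t \<ge> 0 \<Longrightarrow> norm (x t) \<le> sqrt (2 * rtilde l1 l2 p0 / min l1 l2) * exp (- min l1 l2 * sin \<beta> * t)"
    "\<And>t. t \<ge> 0 \<Longrightarrow> weight l1 l2 (x t) \<le> sqrt (2 * max l1 l2 * rtilde l1 l2 p0) * exp (- min l1 l2 * sin \<beta> * t)"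
proof -
  obtain x where x0: "x 0 = p0" and x: "\<And>t. (x has_vector_derivative system_matrix l1 l2 \<beta> *v x t) (at t)"
    using planar_linear_ode_solution by blast
  note bd = rtilde_solution_bounds[OF x, unfolded x0]
  show thesis
  proof
    fix t :: real assume t: "t \<ge> 0"
    have r0: "rtilde l1 l2 p0 > 0" using rtilde_pos_iff[OF l1 l2] p0 by simp
    have "0 < rtilde l1 l2 p0 * exp (- 2 * max l1 l2 * sin \<beta> * t)" using r0 by simp
    with bd(2)[OF t] have "rtilde l1 l2 (x t) > 0" by linarith
    then show "x t \<noteq> 0" using rtilde_pos_iff[OF l1 l2] by simp
    have sq: "(exp (- min l1 l2 * sin \<beta> * t))\<^sup>2 = exp (- 2 * min l1 l2 * sin \<beta> * t)"
      by (simp add: power2_eq_square exp_add[symmetric])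
    have mn: "min l1 l2 > 0" using l1 l2 by simp
    have "(norm (x t))\<^sup>2 \<le> 2 / min l1 l2 * rtilde l1 l2 (x t)"
      using norm_squared_le_rtilde[OF l1 l2, of "x t"] mn by (simp add: field_simps)
    also have "\<dots> \<le> 2 / min l1 l2 * (rtilde l1 l2 p0 * exp (- 2 * min l1 l2 * sin \<beta> * t))"
      using bd(1)[OF t] mn by (intro mult_left_mono) auto
    also have "\<dots> = (sqrt (2 * rtilde l1 l2 p0 / min l1 l2) * exp (- min l1 l2 * sin \<beta> * t))\<^sup>2"
      using r0 mn unfolding power_mult_distrib sq by simp
    finally show "norm (x t) \<le> sqrt (2 * rtilde l1 l2 p0 / min l1 l2) * exp (- min l1 l2 * sin \<beta> * t)"
      using r0 mn by (elim power2_le_imp_le) simp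
    have "(weight l1 l2 (x t))\<^sup>2 \<le> 2 * max l1 l2 * rtilde l1 l2 (x t)"
      using weight_squared_le[OF l1 l2] .
    also have "\<dots> \<le> 2 * max l1 l2 * (rtilde l1 l2 p0 * exp (- 2 * min l1 l2 * sin \<beta> * t))"
      using bd(1)[OF t] l1 l2 by (intro mult_left_mono) auto
    also have "\<dots> = (sqrt (2 * max l1 l2 * rtilde l1 l2 p0) * exp (- min l1 l2 * sin \<beta> * t))\<^sup>2"
      using r0 l1 l2 unfolding power_mult_distrib sq by simp
    finally show "weight l1 l2 (x t) \<le> sqrt (2 * max l1 l2 * rtilde l1 l2 p0) * exp (- min l1 l2 * sin \<beta> * t)"
      using r0 l1 l2 by (elim power2_le_imp_le) simp
  qed (rule x0 x)+
qed

text \<open>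
  The solution on the half-line as a Lipschitz curve on the unit interval that ends at the origin.
  The quadratic form decreases strictly along it and so identifies its points.
\<close>

lemma spiral_curve:
  assumes p0: "p0 \<noteq> 0"
  obtains x c L where "x 0 = p0" "\<And>t. (x has_vector_derivative system_matrix l1 l2 \<beta> *v x t) (at t)"
    "(x \<longlongrightarrow> 0) at_top" "L-lipschitz_on {0..1} c" "c 0 = p0" "c 1 = 0"
    "c ` {0..1} = insert 0 (x ` {0..})"
    "\<And>t. 0 \<le> t \<Longrightarrow> t < 1 \<Longrightarrow> \<exists>k\<ge>0. (c has_vector_derivative k *\<^sub>R (system_matrix l1 l2 \<beta> *v c t)) (at t)"
    "\<And>s t. 0 \<le> s \<Longrightarrow> s < t \<Longrightarrow> t \<le> 1 \<Longrightarrow> rtilde l1 l2 (c t) < rtilde l1 l2 (c s)"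
proof -
  let ?M = "\<lambda>p. system_matrix l1 l2 \<beta> *v p"
  have sb: "sin \<beta> > 0" using beta by (rule sin_gt_zero)
  define m where "m = min l1 l2 * sin \<beta>"
  have m: "m > 0" using l1 l2 sb by (simp add: m_def)
  define V where "V = sqrt (2 * rtilde l1 l2 p0 / min l1 l2)"
  define W where "W = sqrt (2 * max l1 l2 * rtilde l1 l2 p0)"
  have V: "V \<ge> 0" and W: "W \<ge> 0"
    using rtilde_nonneg[OF l1 l2, of p0] l1 l2 by (auto simp: V_def W_def)
  obtain x where x0: "x 0 = p0" and x: "\<And>t. (x has_vector_derivative ?M (x t)) (at t)"
    and xnz: "\<And>t. t \<ge> 0 \<Longrightarrow> x t \<noteq> 0"
    and xn': "\<And>t. t \<ge> 0 \<Longrightarrow> norm (x t) \<le> V * exp (- min l1 l2 * sin \<beta> * t)"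
    and xw': "\<And>t. t \<ge> 0 \<Longrightarrow> weight l1 l2 (x t) \<le> W * exp (- min l1 l2 * sin \<beta> * t)"
    by (rule spiral_solution[OF p0, folded V_def W_def]) (rule that)
  have em: "exp (- min l1 l2 * sin \<beta> * t) = exp (- m * t)" for t by (simp add: m_def)
  note xn = xn'[unfolded em] and xw = xw'[unfolded em]
  have lim: "(x \<longlongrightarrow> 0) at_top"
  proof (rule Lim_null_comparison)
    show "\<forall>\<^sub>F t in at_top. norm (x t) \<le> V * exp (- m * t)"
      using eventually_ge_at_top[of 0] by eventually_elim (rule xn)
    have "filterlim (\<lambda>t. - m * t) at_bot at_top"
      using m by (intro filterlim_tendsto_neg_mult_at_bot[OF tendsto_const _ filterlim_ident]) auto
    then show "((\<lambda>t. V * exp (- m * t)) \<longlongrightarrow> 0) at_top"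
      by (intro tendsto_mult_right_zero filterlim_compose[OF exp_at_bot])
  qed
  \<comment> \<open>This time change turns the decay \<open>exp (- m * \<tau> t)\<close> into \<open>1 - t\<close>, which cancels the factor by which
    the clock speeds up; the speed of \<open>c\<close> therefore stays bounded up to \<open>t = 1\<close>.\<close>
  define \<tau> where "\<tau> t = - ln (1 - t) / m" for t :: real
  define c where "c t = (if t < 1 then x (\<tau> t) else 0)" for t
  have \<tau>0: "\<tau> t \<ge> 0" if "0 \<le> t" "t < 1" for t
    using that m by (auto simp: \<tau>_def field_simps)
  have \<tau>e: "exp (- m * \<tau> t) = 1 - t" if "t < 1" for t
    using that m by (simp add: \<tau>_def)
  have \<tau>mono: "\<tau> s < \<tau> t" if "s < t" "t < 1" for s t
    using that m by (simp add: \<tau>_def divide_strict_right_mono)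
  have \<tau>d: "(\<tau> has_real_derivative 1 / (m * (1 - t))) (at t)" if "t < 1" for t
    unfolding \<tau>_def using that m by (auto intro!: derivative_eq_intros simp: field_simps)
  have cd: "(c has_vector_derivative (1 / (m * (1 - t))) *\<^sub>R ?M (c t)) (at t)" if t: "t < 1" for t
  proof -
    have "((x \<circ> \<tau>) has_vector_derivative (1 / (m * (1 - t))) *\<^sub>R ?M (x (\<tau> t))) (at t)"
      by (rule vector_diff_chain_at[OF _ x])
         (use \<tau>d[OF t] in \<open>simp add: has_real_derivative_iff_has_vector_derivative\<close>)
    then have "(c has_vector_derivative (1 / (m * (1 - t))) *\<^sub>R ?M (x (\<tau> t))) (at t)"
      by (rule has_vector_derivative_transform_within_open[of _ _ _ "{..<1}"])
         (use t in \<open>auto simp: c_def\<close>)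
    then show ?thesis using t by (simp add: c_def)
  qed
  have cn: "norm (c t) \<le> V * (1 - t)" if "0 \<le> t" "t \<le> 1" for t
    using xn[OF \<tau>0] \<tau>e that by (cases "t < 1") (auto simp: c_def)
  have lip1: "(W / m)-lipschitz_on {0..<1} c"
  proof (rule bounded_derivative_imp_lipschitz)
    fix t :: real assume t: "t \<in> {0..<1}"
    let ?v = "(1 / (m * (1 - t))) *\<^sub>R ?M (c t)"
    show "(c has_derivative (\<lambda>h. h *\<^sub>R ?v)) (at t within {0..<1})"
      using cd[of t] t by (auto simp: has_vector_derivative_def intro: has_derivative_at_withinI)
    have "weight l1 l2 (c t) \<le> W * (1 - t)"
      using xw[OF \<tau>0, of t] \<tau>e[of t] t by (simp add: c_def)
    then have "norm ?v \<le> W / m"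
      using t m by (simp add: norm_system_matrix abs_mult pos_divide_le_eq)
    then show "onorm (\<lambda>h. h *\<^sub>R ?v) \<le> W / m"
      by (intro onorm_le) (simp only: norm_scaleR[of _ ?v] mult.commute[of "\<bar>_\<bar>"] real_norm_def mult_right_mono abs_ge_zero)
  qed (use W m in auto)
  define L where "L = max (W / m) V"
  have lip: "L-lipschitz_on {0..1} c"
  proof (rule lipschitz_on_leI)
    show "0 \<le> L" using V by (simp add: L_def)
    fix s t :: real assume st: "s \<in> {0..1}" "t \<in> {0..1}" "s \<le> t"
    show "dist (c s) (c t) \<le> L * dist s t"
    proof (cases "t < 1")
      case True
      then have "dist (c s) (c t) \<le> W / m * dist s t"
        using st by (intro lipschitz_onD[OF lip1]) auto
      also have "\<dots> \<le> L * dist s t" by (intro mult_right_mono) (auto simp: L_def)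
      finally show ?thesis .
    next
      case False
      then have "t = 1" using st by simp
      then have "dist (c s) (c t) \<le> V * (1 - s)" using cn[of s] st by (simp add: c_def dist_norm)
      also have "\<dots> \<le> L * dist s t" using st \<open>t = 1\<close>
        by (auto simp: L_def dist_real_def intro!: mult_right_mono)
      finally show ?thesis .
    qed
  qed
  have img: "c ` {0..1} = insert 0 (x ` {0..})"
  proof (intro equalityI subsetI)
    fix p assume "p \<in> c ` {0..1}"
    then show "p \<in> insert 0 (x ` {0..})" using \<tau>0 by (auto simp: c_def)
  next
    fix p assume "p \<in> insert 0 (x ` {0..})"
    then consider "p = 0" | u where "u \<ge> 0" "p = x u" by auto
    then show "p \<in> c ` {0..1}"
    proof cases
      case 1
      then show ?thesis by (intro image_eqI[of _ _ 1]) (auto simp: c_def)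
    next
      case 2
      define t where "t = 1 - exp (- m * u)"
      have "\<tau> t = u" "t < 1" using m by (auto simp: \<tau>_def t_def)
      moreover have "t \<ge> 0" using m 2 by (simp add: t_def)
      ultimately show ?thesis using 2 by (intro image_eqI[of _ _ t]) (auto simp: c_def)
    qed
  qed
  have mono: "rtilde l1 l2 (c t) < rtilde l1 l2 (c s)" if st: "0 \<le> s" "s < t" "t \<le> 1" for s t
  proof (cases "t < 1")
    case True
    have "rtilde l1 l2 (x (\<tau> t)) < rtilde l1 l2 (x (\<tau> s))"
    proof (rule DERIV_neg_imp_decreasing[OF \<tau>mono[OF st(2) True]], intro exI conjI)
      fix u assume "\<tau> s \<le> u"
      then have "x u \<noteq> 0" using xnz \<tau>0[of s] st by auto
      then have "weight l1 l2 (x u) \<noteq> 0" by (simp add: weight_eq_0_iff[OF l1 l2])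
      then show "- sin \<beta> * (weight l1 l2 (x u))\<^sup>2 < 0" using sb by simp
      show "((\<lambda>u. rtilde l1 l2 (x u)) has_real_derivative - sin \<beta> * (weight l1 l2 (x u))\<^sup>2) (at u)"
        using has_real_derivative_rtilde[OF x, of l1 l2] unfolding gradient_inner_system .
    qed
    then show ?thesis using st True by (simp add: c_def)
  next
    case False
    then show ?thesis using st xnz[OF \<tau>0, of s] by (simp add: c_def rtilde_pos_iff[OF l1 l2])
  qed
  show thesis
  proof (rule that[OF x0 x lim lip _ _ img _ mono])
    show "c 0 = p0" by (simp add: c_def \<tau>_def x0)
    show "c 1 = 0" by (simp add: c_def)
    show "\<exists>k\<ge>0. (c has_vector_derivative k *\<^sub>R ?M (c t)) (at t)" if "0 \<le> t" "t < 1" for t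
      using cd[OF that(2)] m that(2) by (intro exI[of _ "1 / (m * (1 - t))"]) simp
  qed
qed

end

lemma lipschitz_on_ode_solution:
  fixes A :: "real^'n^'n"
  assumes x: "\<And>t. (x has_vector_derivative A *v x t) (at t)"
  obtains B where "B-lipschitz_on {a..b} x"
proof -
  have "continuous_on {a..b} x"
    using x has_vector_derivative_continuous by (blast intro: continuous_at_imp_continuous_on)
  then have "continuous_on {a..b} (\<lambda>t. A *v x t)"
    by (intro continuous_on_compose2[OF matrix_vector_mult_linear_continuous_on[of UNIV A]]) auto
  then have "bounded ((\<lambda>t. A *v x t) ` {a..b})"
    by (intro compact_imp_bounded compact_continuous_image) auto
  then obtain B where B: "B > 0" "\<And>t. t \<in> {a..b} \<Longrightarrow> norm (A *v x t) \<le> B"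
    unfolding bounded_pos by (auto simp: image_iff)
  have "B-lipschitz_on {a..b} x"
  proof (rule bounded_derivative_imp_lipschitz)
    fix t assume t: "t \<in> {a..b}"
    show "(x has_derivative (\<lambda>h. h *\<^sub>R (A *v x t))) (at t within {a..b})"
      using x[of t] by (auto simp: has_vector_derivative_def intro: has_derivative_at_withinI)
    show "onorm (\<lambda>h. h *\<^sub>R (A *v x t)) \<le> B"
    proof (rule onorm_le)
      fix h :: real
      show "norm (h *\<^sub>R (A *v x t)) \<le> B * norm h"
        using mult_right_mono[OF B(2)[OF t], of "norm h"] by (simp add: mult.commute)
    qed
  qed (use B in auto)
  then show thesis by (rule that)
qed

section \<open>Integrals along Lipschitz curves\<close>

lemma locally_lipschitz_on_unit_interval:
  assumes "locally_lipschitz_on {0..1} \<gamma>"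
  obtains L where "L-lipschitz_on {0..1} \<gamma>"
proof -
  have "local_lipschitz {0::real} {0..1} (\<lambda>_. \<gamma>)"
    unfolding local_lipschitz_def
  proof (intro ballI)
    fix t s :: real assume "t \<in> {0..1}" "s \<in> {0}"
    then obtain u L where u: "u > 0" "L-lipschitz_on (ball t u \<inter> {0..1}) \<gamma>"
      using assms unfolding locally_lipschitz_on_def by blast
    have "L-lipschitz_on (cball t (u/2) \<inter> {0..1}) \<gamma>"
      by (rule lipschitz_on_subset[OF u(2)]) (use u(1) in auto)
    then show "\<exists>u>0. \<exists>L. \<forall>s\<in>cball s u \<inter> {0}. L-lipschitz_on (cball t u \<inter> {0..1}) \<gamma>"
      using u(1) by (intro exI[of _ "u/2"]) auto
  qed
  then show thesis
    by (rule local_lipschitz_compact_implies_lipschitz) (auto intro: that)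
qed

lemma lipschitz_imp_locally_lipschitz_on:
  "L-lipschitz_on T \<gamma> \<Longrightarrow> locally_lipschitz_on T \<gamma>"
  unfolding locally_lipschitz_on_def
  by (metis lipschitz_on_subset inf_le2 zero_less_one)

lemma lipschitz_on_vec_nth:
  fixes \<gamma> :: "real \<Rightarrow> real^'n"
  assumes "L-lipschitz_on T \<gamma>"
  shows "L-lipschitz_on T (\<lambda>t. \<gamma> t $ i)"
proof (rule lipschitz_onI)
  fix x y assume "x \<in> T" "y \<in> T"
  then have "dist (\<gamma> x) (\<gamma> y) \<le> L * dist x y" by (rule lipschitz_onD[OF assms])
  then show "dist (\<gamma> x $ i) (\<gamma> y $ i) \<le> L * dist x y"
    using component_le_norm_cart[of "\<gamma> x - \<gamma> y" i] by (simp add: dist_norm)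
qed (use assms in \<open>simp add: lipschitz_on_def\<close>)

lemma lipschitz_on_mult_compact:
  fixes f g :: "real \<Rightarrow> real"
  assumes f: "L-lipschitz_on {a..b} f" and g: "M-lipschitz_on {a..b} g"
  obtains K where "K-lipschitz_on {a..b} (\<lambda>t. f t * g t)"
proof -
  have "bounded (f ` {a..b})" "bounded (g ` {a..b})"
    using f g by (auto intro!: compact_imp_bounded compact_continuous_image lipschitz_on_continuous_on)
  then obtain B C where B: "B > 0" "\<And>x. x \<in> {a..b} \<Longrightarrow> \<bar>f x\<bar> \<le> B"
    and C: "C > 0" "\<And>x. x \<in> {a..b} \<Longrightarrow> \<bar>g x\<bar> \<le> C"
    unfolding bounded_pos by (auto simp: image_iff)
  show thesis
  proof (rule that, rule lipschitz_onI)
    have LM: "L \<ge> 0" "M \<ge> 0" using f g by (auto simp: lipschitz_on_def)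
    then show "0 \<le> B * M + C * L" using B C by simp
    fix x y assume xy: "x \<in> {a..b}" "y \<in> {a..b}"
    have "f x * g x - f y * g y = f x * (g x - g y) + g y * (f x - f y)"
      by (simp add: algebra_simps)
    then have "\<bar>f x * g x - f y * g y\<bar> \<le> \<bar>f x\<bar> * \<bar>g x - g y\<bar> + \<bar>g y\<bar> * \<bar>f x - f y\<bar>"
      by (metis abs_mult abs_triangle_ineq)
    also have "\<dots> \<le> B * (M * \<bar>x - y\<bar>) + C * (L * \<bar>x - y\<bar>)"
      using lipschitz_onD[OF f xy] lipschitz_onD[OF g xy] B C xy LM
      by (intro add_mono mult_mono) (auto simp: dist_real_def)
    finally show "dist (f x * g x) (f y * g y) \<le> (B * M + C * L) * dist x y"
      by (simp add: dist_real_def algebra_simps)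
  qed
qed

lemma lipschitz_on_rtilde_curve:
  fixes \<gamma> :: "real \<Rightarrow> real^2"
  assumes \<gamma>: "L-lipschitz_on {a..b} \<gamma>"
  obtains K where "K-lipschitz_on {a..b} (\<lambda>t. rtilde l1 l2 (\<gamma> t))"
proof -
  note lip = lipschitz_on_vec_nth[OF \<gamma>]
  obtain K1 where K1: "K1-lipschitz_on {a..b} (\<lambda>t. \<gamma> t $ 1 * \<gamma> t $ 1)"
    by (rule lipschitz_on_mult_compact[OF lip lip])
  obtain K2 where K2: "K2-lipschitz_on {a..b} (\<lambda>t. \<gamma> t $ 2 * \<gamma> t $ 2)"
    by (rule lipschitz_on_mult_compact[OF lip lip])
  have "(\<bar>l1/2\<bar> * K1 + \<bar>l2/2\<bar> * K2)-lipschitz_on {a..b} (\<lambda>t. l1/2 * (\<gamma> t $ 1 * \<gamma> t $ 1) + l2/2 * (\<gamma> t $ 2 * \<gamma> t $ 2))"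
    by (intro lipschitz_on_add lipschitz_on_cmult_real K1 K2)
  also have "(\<lambda>t. l1/2 * (\<gamma> t $ 1 * \<gamma> t $ 1) + l2/2 * (\<gamma> t $ 2 * \<gamma> t $ 2)) = (\<lambda>t. rtilde l1 l2 (\<gamma> t))"
    by (simp add: rtilde_def power2_eq_square field_simps)
  finally show thesis by (rule that)
qed

lemma lipschitz_derivative_bound:
  fixes f :: "real \<Rightarrow> 'a::real_normed_vector"
  assumes f: "L-lipschitz_on {a..b} f" and x: "x \<in> {a..b}" and ab: "a < b"
    and v: "(f has_vector_derivative v) (at x within {a..b})"
  shows "norm v \<le> L"
proof (rule field_le_epsilon)
  fix e :: real assume "e > 0"
  then obtain d where d: "d > 0" "\<And>y. y \<in> {a..b} \<Longrightarrow> norm (y - x) < d \<Longrightarrow>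
      norm (f y - f x - (y - x) *\<^sub>R v) \<le> e * norm (y - x)"
    using v unfolding has_vector_derivative_def has_derivative_within_alt by blast
  obtain y where y: "y \<in> {a..b}" "norm (y - x) < d" "y \<noteq> x"
  proof (cases "x < b")
    case True
    then show ?thesis using d x by (intro that[of "x + min (d/2) (b - x)"]) auto
  next
    case False
    then show ?thesis using d x ab by (intro that[of "x - min (d/2) (x - a)"]) auto
  qed
  have "norm ((y - x) *\<^sub>R v) \<le> norm (f y - f x) + norm (f y - f x - (y - x) *\<^sub>R v)"
    using norm_triangle_ineq4[of "f y - f x" "f y - f x - (y - x) *\<^sub>R v"] by simp
  also have "\<dots> \<le> L * norm (y - x) + e * norm (y - x)"
    using d(2)[OF y(1,2)] lipschitz_onD[OF f y(1) x] by (simp add: dist_norm)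
  also have "norm ((y - x) *\<^sub>R v) = norm (y - x) * norm v" by simp
  finally have "norm (y - x) * norm v \<le> norm (y - x) * (L + e)"
    by (simp only: distrib_left mult.commute[of L] mult.commute[of e])
  then show "norm v \<le> L + e" using y(3) by simp
qed

text \<open>
  The derivative is bounded wherever it exists. On the exceptional null set its value is arbitrary and is replaced by zero.
\<close>

lemma lipschitz_derivative_absolutely_integrable:
  fixes f :: "real \<Rightarrow> 'a::euclidean_space"
  assumes f: "L-lipschitz_on {a..b} f" and ab: "a < b"
  shows "(\<lambda>t. vector_derivative f (at t within {a..b})) absolutely_integrable_on {a..b}"
proof -
  let ?f' = "\<lambda>t. vector_derivative f (at t within {a..b})"
  obtain N where N: "negligible N" "\<And>x. x \<in> {a..b} - N \<Longrightarrow> (f has_vector_derivative ?f' x) (at x within {a..b})"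
    by (rule lipschitz_ae_has_vector_derivative[OF f ab]) (rule that)
  have int: "?f' integrable_on {a..b}"
    using lipschitz_has_integral_ae_derivative[OF f less_imp_le[OF ab] N] by blast
  have "(\<lambda>t. if t \<in> N then 0 else ?f' t) integrable_on {a..b}"
    by (rule integrable_spike[OF int N(1)]) auto
  then have "(\<lambda>t. if t \<in> N then 0 else ?f' t) absolutely_integrable_on {a..b}"
  proof (rule absolutely_integrable_integrable_bound[rotated])
    show "(\<lambda>t. L) integrable_on {a..b}" by (rule integrable_const_ivl)
    show "norm (if t \<in> N then 0 else ?f' t) \<le> L" if "t \<in> {a..b}" for t
      using lipschitz_derivative_bound[OF f that ab] N(2)[of t] that lipschitz_on_nonneg[OF f] by auto
  qed
  then show ?thesis by (rule absolutely_integrable_spike[OF _ N(1)]) auto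
qed

lemma continuous_mult_absolutely_integrable:
  fixes g h :: "real \<Rightarrow> real"
  assumes g: "continuous_on {a..b} g" and h: "h absolutely_integrable_on {a..b}"
  shows "(\<lambda>t. g t * h t) integrable_on {a..b}"
proof -
  have "(\<lambda>t. g t * h t) absolutely_integrable_on {a..b}"
    using g h by (intro absolutely_integrable_bounded_measurable_product_real)
      (auto intro!: continuous_imp_measurable_on_sets_lebesgue compact_imp_bounded compact_continuous_image)
  then show ?thesis by (rule set_lebesgue_integral_eq_integral)
qed

lemma curve_integrable:
  assumes \<gamma>: "L-lipschitz_on {0..1} \<gamma>" and g: "continuous_on {0..1} g"
  shows "(\<lambda>t. g t * norm (curve_deriv \<gamma> t)) integrable_on {0..1}"
    and "(\<lambda>t. g t * curve_deriv \<gamma> t $ i) integrable_on {0..1}"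
proof -
  have ai: "curve_deriv \<gamma> absolutely_integrable_on {0..1}"
    using lipschitz_derivative_absolutely_integrable[OF \<gamma>] by simp
  show "(\<lambda>t. g t * norm (curve_deriv \<gamma> t)) integrable_on {0..1}"
    by (rule continuous_mult_absolutely_integrable[OF g absolutely_integrable_norm[OF ai, unfolded o_def]])
  show "(\<lambda>t. g t * curve_deriv \<gamma> t $ i) integrable_on {0..1}"
    by (rule continuous_mult_absolutely_integrable[OF g
          absolutely_integrable_linear[OF ai bounded_linear_vec_nth, unfolded o_def]])
qed

text \<open>
  The exact forms \<open>dr\<close> and \<open>d(p1 p2)\<close> integrate to differences of end values; area and energy integrands are integrable,
  so that the defining integrals are meaningful.
\<close>

lemma curve_integrals:
  assumes \<gamma>: "L-lipschitz_on {0..1} \<gamma>" and ends: "\<gamma> 0 = p0" "\<gamma> 1 = 0"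
  shows "((\<lambda>t. l1 * \<gamma> t $ 1 * curve_deriv \<gamma> t $ 1 + l2 * \<gamma> t $ 2 * curve_deriv \<gamma> t $ 2)
           has_integral - rtilde l1 l2 p0) {0..1}"
    and "((\<lambda>t. \<gamma> t $ 1 * curve_deriv \<gamma> t $ 2 + \<gamma> t $ 2 * curve_deriv \<gamma> t $ 1)
           has_integral - (p0 $ 1 * p0 $ 2)) {0..1}"
    and "((\<lambda>t. \<gamma> t $ 2 * curve_deriv \<gamma> t $ 1) has_integral - area \<gamma>) {0..1}"
    and "continuous_on UNIV F \<Longrightarrow> ((\<lambda>t. F (\<gamma> t) * norm (curve_deriv \<gamma> t)) has_integral energy F \<gamma>) {0..1}"
proof -
  obtain N where N: "negligible N" and d: "\<And>t. t \<in> {0..1} - N \<Longrightarrow>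
      (\<gamma> has_vector_derivative curve_deriv \<gamma> t) (at t within {0..1})"
    by (rule lipschitz_ae_has_vector_derivative[OF \<gamma> zero_less_one]) (rule that)
  note lip = lipschitz_on_vec_nth[OF \<gamma>]
  have prod: "((\<lambda>t. \<gamma> t $ i * curve_deriv \<gamma> t $ j + \<gamma> t $ j * curve_deriv \<gamma> t $ i)
           has_integral - (p0 $ i * p0 $ j)) {0..1}" for i j
  proof -
    obtain K where K: "K-lipschitz_on {0..1} (\<lambda>t. \<gamma> t $ i * \<gamma> t $ j)"
      by (rule lipschitz_on_mult_compact[OF lip lip])
    have "((\<lambda>t. \<gamma> t $ i * curve_deriv \<gamma> t $ j + \<gamma> t $ j * curve_deriv \<gamma> t $ i)
           has_integral (\<gamma> 1 $ i * \<gamma> 1 $ j - \<gamma> 0 $ i * \<gamma> 0 $ j)) {0..1}"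
    proof (rule lipschitz_has_integral_ae_derivative[OF K _ N])
      fix t assume t: "t \<in> {0..1} - N"
      note D = has_real_derivative_vec_nth[OF d[OF t]]
      show "((\<lambda>t. \<gamma> t $ i * \<gamma> t $ j) has_vector_derivative
          (\<gamma> t $ i * curve_deriv \<gamma> t $ j + \<gamma> t $ j * curve_deriv \<gamma> t $ i)) (at t within {0..1})"
        unfolding has_real_derivative_iff_has_vector_derivative[symmetric]
        using DERIV_mult[OF D[of i] D[of j]] by (simp add: algebra_simps)
    qed simp
    then show ?thesis by (simp add: ends)
  qed
  show "((\<lambda>t. \<gamma> t $ 1 * curve_deriv \<gamma> t $ 2 + \<gamma> t $ 2 * curve_deriv \<gamma> t $ 1)
           has_integral - (p0 $ 1 * p0 $ 2)) {0..1}" by (rule prod)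
  show "((\<lambda>t. l1 * \<gamma> t $ 1 * curve_deriv \<gamma> t $ 1 + l2 * \<gamma> t $ 2 * curve_deriv \<gamma> t $ 2)
           has_integral - rtilde l1 l2 p0) {0..1}"
  proof -
    have "l1 / 2 * - (p0 $ 1 * p0 $ 1) + l2 / 2 * - (p0 $ 2 * p0 $ 2) = - rtilde l1 l2 p0"
      by (simp add: rtilde_def power2_eq_square field_simps)
    then show ?thesis
      using has_integral_add[OF has_integral_mult_right[OF prod[of 1 1], of "l1/2"]
        has_integral_mult_right[OF prod[of 2 2], of "l2/2"]]
      by (simp add: mult.assoc)
  qed
  have cont: "continuous_on {0..1} \<gamma>" by (rule lipschitz_on_continuous_on[OF \<gamma>])
  have "continuous_on {0..1} (\<lambda>t. \<gamma> t $ 2)" using cont by (intro continuous_intros)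
  from curve_integrable(2)[OF \<gamma> this] 
  show "((\<lambda>t. \<gamma> t $ 2 * curve_deriv \<gamma> t $ 1) has_integral - area \<gamma>) {0..1}"
    unfolding area_def by (simp add: integrable_integral)
  show "((\<lambda>t. F (\<gamma> t) * norm (curve_deriv \<gamma> t)) has_integral energy F \<gamma>) {0..1}"
    if F: "continuous_on UNIV F"
  proof -
    have "continuous_on {0..1} (\<lambda>t. F (\<gamma> t))" by (rule continuous_on_compose2[OF F cont]) simp
    from curve_integrable(1)[OF \<gamma> this] show ?thesis
      unfolding energy_def by (rule integrable_integral)
  qed
qed

text \<open>
  The form \<open>\<omega>\<^sub>0 - \<omega>\<^sub>1\<close> equals \<open>- l1 / (l1 + l2)\<close> times \<open>d(p1 p2)\<close>.
\<close>

lemma Atilde_eq: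
  assumes "l1 + l2 > 0"
  shows "(l1 + l2) * Atilde l1 l2 A p0 = (l1 + l2) * A - l1 * p0 $ 1 * p0 $ 2"
proof -
  have lip: "(norm p0)-lipschitz_on {0..1} (linepath p0 0)"
    by (rule lipschitz_onI)
       (auto simp: linepath_def dist_norm scaleR_diff_left[symmetric] abs_minus_commute simp del: scaleR_diff_left)
  have eq: "(omega0 p - omega1 l1 l2 p) \<bullet> v = - l1 / (l1 + l2) * (p $ 1 * v $ 2 + p $ 2 * v $ 1)" for p v
  proof -
    define c where "c = 1 / (l1 + l2)"
    have c: "(l1 + l2) * c = 1" using assms by (simp add: c_def)
    have "(omega0 p - omega1 l1 l2 p) \<bullet> v = - (p $ 2 * v $ 1) - c * (- l2 * p $ 2 * v $ 1 + l1 * p $ 1 * v $ 2)"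
      by (simp add: omega0_def omega1_def inner_real2 c_def[symmetric] algebra_simps)
    also have "\<dots> = - l1 * c * (p $ 1 * v $ 2 + p $ 2 * v $ 1)" using c by algebra
    finally show ?thesis by (simp add: c_def)
  qed
  have "((\<lambda>t. (omega0 (linepath p0 0 t) - omega1 l1 l2 (linepath p0 0 t)) \<bullet> curve_deriv (linepath p0 0) t)
      has_integral (- l1 / (l1 + l2) * - (p0 $ 1 * p0 $ 2))) {0..1}"
    unfolding eq by (rule has_integral_mult_right[OF curve_integrals(2)[OF lip]]) (simp_all add: linepath_def)
  then have "line_integral (\<lambda>p. omega0 p - omega1 l1 l2 p) (linepath p0 0) = l1 / (l1 + l2) * (p0 $ 1 * p0 $ 2)"
    unfolding line_integral_def by (simp add: integral_unique)
  then show ?thesis using assms by (simp add: Atilde_def field_simps)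
qed

section \<open>The calibration\<close>

text \<open>
  The decomposition into the two exact forms and the area form.
\<close>

lemma system_inner:
  "(system_matrix l1 l2 \<beta> *v p) \<bullet> v = - sin \<beta> * (l1 * p $ 1 * v $ 1 + l2 * p $ 2 * v $ 2)
     + (cos \<beta> * l1) * (p $ 1 * v $ 2 + p $ 2 * v $ 1) - (cos \<beta> * (l1 + l2)) * (p $ 2 * v $ 1)"
  unfolding inner_real2 system_matrix_apply by algebra

lemma calibration_integral:
  assumes \<gamma>: "L-lipschitz_on {0..1} \<gamma>" and ends: "\<gamma> 0 = p0" "\<gamma> 1 = 0" and l: "l1 + l2 > 0"
  shows "((\<lambda>t. (system_matrix l1 l2 \<beta> *v \<gamma> t) \<bullet> curve_deriv \<gamma> t) has_integral
     sin \<beta> * rtilde l1 l2 p0 + cos \<beta> * (l1 + l2) * Atilde l1 l2 (area \<gamma>) p0) {0..1}"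
proof -
  note I = curve_integrals[OF \<gamma> ends]
  have "((\<lambda>t. (system_matrix l1 l2 \<beta> *v \<gamma> t) \<bullet> curve_deriv \<gamma> t) has_integral
     - sin \<beta> * - rtilde l1 l2 p0 + (cos \<beta> * l1) * - (p0 $ 1 * p0 $ 2) - (cos \<beta> * (l1 + l2)) * - area \<gamma>) {0..1}"
    unfolding system_inner
    by (intro has_integral_diff has_integral_add has_integral_mult_right I(1-3))
  also have "- sin \<beta> * - rtilde l1 l2 p0 + (cos \<beta> * l1) * - (p0 $ 1 * p0 $ 2) - (cos \<beta> * (l1 + l2)) * - area \<gamma>
    = sin \<beta> * rtilde l1 l2 p0 + cos \<beta> * ((l1 + l2) * Atilde l1 l2 (area \<gamma>) p0)"
    unfolding Atilde_eq[OF l] by (simp add: algebra_simps)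
  finally show ?thesis by (simp add: mult.assoc)
qed

lemma calibration_inequality:
  assumes \<gamma>: "L-lipschitz_on {0..1} \<gamma>" and ends: "\<gamma> 0 = p0" "\<gamma> 1 = 0" and l: "l1 + l2 > 0"
  shows "sin \<beta> * rtilde l1 l2 p0 + cos \<beta> * (l1 + l2) * Atilde l1 l2 (area \<gamma>) p0 \<le> energy (weight l1 l2) \<gamma>"
  by (rule has_integral_le[OF calibration_integral[OF \<gamma> ends l] curve_integrals(4)[OF \<gamma> ends continuous_weight]])
     (metis norm_cauchy_schwarz norm_system_matrix)

text \<open>
  Equality of the integrals means equality in Cauchy-Schwarz almost everywhere, that is, the velocity
  is parallel to the calibrating field.
\<close>

lemma calibration_equality:
  assumes \<gamma>: "L-lipschitz_on {0..1} \<gamma>" and ends: "\<gamma> 0 = p0" "\<gamma> 1 = 0" and l: "l1 + l2 > 0"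
    and eq: "energy (weight l1 l2) \<gamma> = sin \<beta> * rtilde l1 l2 p0 + cos \<beta> * (l1 + l2) * Atilde l1 l2 (area \<gamma>) p0"
  obtains N where "negligible N" "\<And>t. t \<in> {0..1} - N \<Longrightarrow>
      (\<gamma> has_vector_derivative curve_deriv \<gamma> t) (at t within {0..1})"
    "\<And>t. t \<in> {0..1} - N \<Longrightarrow> weight l1 l2 (\<gamma> t) *\<^sub>R curve_deriv \<gamma> t
      = norm (curve_deriv \<gamma> t) *\<^sub>R (system_matrix l1 l2 \<beta> *v \<gamma> t)"
proof -
  let ?M = "\<lambda>t. system_matrix l1 l2 \<beta> *v \<gamma> t"
  have "((\<lambda>t. weight l1 l2 (\<gamma> t) * norm (curve_deriv \<gamma> t) - ?M t \<bullet> curve_deriv \<gamma> t) has_integral 0) {0..1}"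
    using has_integral_diff[OF curve_integrals(4)[OF \<gamma> ends continuous_weight[of UNIV l1 l2]] calibration_integral[OF \<gamma> ends l, of \<beta>]]
    by (simp add: eq)
  then obtain N1 where N1: "negligible N1"
    "\<And>t. t \<in> {0..1} - N1 \<Longrightarrow> weight l1 l2 (\<gamma> t) * norm (curve_deriv \<gamma> t) - ?M t \<bullet> curve_deriv \<gamma> t = 0"
  proof (rule nonneg_has_integral_0_imp_ae_0[OF _ zero_less_one negligible_empty])
    show "0 \<le> weight l1 l2 (\<gamma> t) * norm (curve_deriv \<gamma> t) - ?M t \<bullet> curve_deriv \<gamma> t" for t
      by (metis norm_cauchy_schwarz norm_system_matrix diff_ge_0_iff_ge)
  qed (rule that)
  obtain N2 where N2: "negligible N2" "\<And>t. t \<in> {0..1} - N2 \<Longrightarrow>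
      (\<gamma> has_vector_derivative curve_deriv \<gamma> t) (at t within {0..1})"
    by (rule lipschitz_ae_has_vector_derivative[OF \<gamma> zero_less_one]) (rule that)
  show thesis
  proof (rule that[of "N1 \<union> N2"])
    show "negligible (N1 \<union> N2)" using N1(1) N2(1) by (rule negligible_Un)
    fix t assume t: "t \<in> {0..1} - (N1 \<union> N2)"
    show "(\<gamma> has_vector_derivative curve_deriv \<gamma> t) (at t within {0..1})" by (rule N2(2)) (use t in auto)
    have "?M t \<bullet> curve_deriv \<gamma> t = norm (?M t) * norm (curve_deriv \<gamma> t)"
      using N1(2)[of t] t by (simp add: norm_system_matrix)
    then show "weight l1 l2 (\<gamma> t) *\<^sub>R curve_deriv \<gamma> t = norm (curve_deriv \<gamma> t) *\<^sub>R ?M t"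
      unfolding norm_system_matrix[of l1 l2 \<beta> "\<gamma> t", symmetric] norm_cauchy_schwarz_eq .
  qed
qed

text \<open>
  Along the field the area form is a combination of \<open>dr\<close> and \<open>d(p1 p2)\<close>, since the velocity has a fixed angle to the
  gradient; the area is therefore determined by the starting point and the angle, unless \<open>sin \<beta> = 0\<close>. The velocity is
  parallel to the field before time 1, so the curve attains the calibrated bound.
\<close>

lemma solution_curve_area_energy:
  assumes l: "l1 + l2 > 0" and c: "L-lipschitz_on {0..1} c" and ends: "c 0 = p0" "c 1 = 0"
    and cd: "\<And>t. 0 \<le> t \<Longrightarrow> t < 1 \<Longrightarrow> \<exists>k\<ge>0. (c has_vector_derivative k *\<^sub>R (system_matrix l1 l2 \<beta> *v c t)) (at t)"
  shows "sin \<beta> * ((l1 + l2) * Atilde l1 l2 (area c) p0) = cos \<beta> * rtilde l1 l2 p0"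
    and "energy (weight l1 l2) c = sin \<beta> * rtilde l1 l2 p0 + cos \<beta> * (l1 + l2) * Atilde l1 l2 (area c) p0"
proof -
  have cd': "\<exists>k\<ge>0. curve_deriv c t = k *\<^sub>R (system_matrix l1 l2 \<beta> *v c t)" if "t \<in> {0..1} - {1}" for t
    using cd[of t] that by (auto dest!: vector_derivative_at_within_ivl[of _ _ _ 0 1])
  note I = curve_integrals[OF c ends]
  have "((\<lambda>t. sin \<beta> * (l1 + l2) * (c t $ 2 * curve_deriv c t $ 1)) has_integral
      sin \<beta> * l1 * - (p0 $ 1 * p0 $ 2) + cos \<beta> * - rtilde l1 l2 p0) {0..1}"
  proof (rule has_integral_spike[OF negligible_sing[of 1]])
    show "((\<lambda>t. sin \<beta> * l1 * (c t $ 1 * curve_deriv c t $ 2 + c t $ 2 * curve_deriv c t $ 1)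
         + cos \<beta> * (l1 * c t $ 1 * curve_deriv c t $ 1 + l2 * c t $ 2 * curve_deriv c t $ 2)) has_integral
      sin \<beta> * l1 * - (p0 $ 1 * p0 $ 2) + cos \<beta> * - rtilde l1 l2 p0) {0..1}"
      by (intro has_integral_add has_integral_mult_right I)
    fix t :: real assume "t \<in> {0..1} - {1}"
    then obtain k where k: "curve_deriv c t = k *\<^sub>R (system_matrix l1 l2 \<beta> *v c t)" using cd' by blast
    show "sin \<beta> * (l1 + l2) * (c t $ 2 * curve_deriv c t $ 1) =
       sin \<beta> * l1 * (c t $ 1 * curve_deriv c t $ 2 + c t $ 2 * curve_deriv c t $ 1)
         + cos \<beta> * (l1 * c t $ 1 * curve_deriv c t $ 1 + l2 * c t $ 2 * curve_deriv c t $ 2)"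
      unfolding k vector_scaleR_component system_matrix_apply real_scaleR_def by algebra
  qed
  from has_integral_unique[OF has_integral_mult_right[OF I(3)] this]
  have "sin \<beta> * (l1 + l2) * area c = sin \<beta> * l1 * (p0 $ 1 * p0 $ 2) + cos \<beta> * rtilde l1 l2 p0"
    by simp
  then show "sin \<beta> * ((l1 + l2) * Atilde l1 l2 (area c) p0) = cos \<beta> * rtilde l1 l2 p0"
    unfolding Atilde_eq[OF l] by (simp add: algebra_simps)
  have "((\<lambda>t. weight l1 l2 (c t) * norm (curve_deriv c t)) has_integral
     sin \<beta> * rtilde l1 l2 p0 + cos \<beta> * (l1 + l2) * Atilde l1 l2 (area c) p0) {0..1}"
  proof (rule has_integral_spike[OF negligible_sing[of 1] _ calibration_integral[OF c ends l, of \<beta>]])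
    fix t :: real assume "t \<in> {0..1} - {1}"
    then obtain k where k: "k \<ge> 0" "curve_deriv c t = k *\<^sub>R (system_matrix l1 l2 \<beta> *v c t)" using cd' by blast
    show "weight l1 l2 (c t) * norm (curve_deriv c t) = (system_matrix l1 l2 \<beta> *v c t) \<bullet> curve_deriv c t"
      unfolding k(2) inner_scaleR_right power2_norm_eq_inner[symmetric] norm_scaleR norm_system_matrix
      using k(1) by (simp add: power2_eq_square)
  qed
  then show "energy (weight l1 l2) c = sin \<beta> * rtilde l1 l2 p0 + cos \<beta> * (l1 + l2) * Atilde l1 l2 (area c) p0"
    unfolding energy_def by (rule integral_unique)
qed

section \<open>Curves with equality in the calibration\<close>

context
  fixes l1 l2 \<beta> :: real and \<gamma> :: "real \<Rightarrow> real^2" and L :: real and N :: "real set"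
  assumes l1: "l1 > 0" and l2: "l2 > 0" and beta: "0 < \<beta>" "\<beta> < pi"
    and lip: "L-lipschitz_on {0..1} \<gamma>" and N: "negligible N"
    and deriv: "\<And>t. t \<in> {0..1} - N \<Longrightarrow>
      (\<gamma> has_vector_derivative curve_deriv \<gamma> t) (at t within {0..1})"
    and parallel: "\<And>t. t \<in> {0..1} - N \<Longrightarrow> weight l1 l2 (\<gamma> t) *\<^sub>R curve_deriv \<gamma> t
      = norm (curve_deriv \<gamma> t) *\<^sub>R (system_matrix l1 l2 \<beta> *v \<gamma> t)"
begin

lemma gradient_inner_curve_deriv:
  assumes t: "t \<in> {0..1} - N"
  shows "l1 * \<gamma> t $ 1 * curve_deriv \<gamma> t $ 1 + l2 * \<gamma> t $ 2 * curve_deriv \<gamma> t $ 2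
    = - sin \<beta> * weight l1 l2 (\<gamma> t) * norm (curve_deriv \<gamma> t)"
proof (cases "\<gamma> t = 0")
  case True
  then show ?thesis by (simp add: weight_def)
next
  case False
  then have w: "weight l1 l2 (\<gamma> t) \<noteq> 0" by (simp add: weight_eq_0_iff[OF l1 l2])
  have p: "weight l1 l2 (\<gamma> t) * curve_deriv \<gamma> t $ i = norm (curve_deriv \<gamma> t) * (system_matrix l1 l2 \<beta> *v \<gamma> t) $ i" for i
    using arg_cong[OF parallel[OF t], of "\<lambda>v. v $ i"] by simp
  have "weight l1 l2 (\<gamma> t) * (l1 * \<gamma> t $ 1 * curve_deriv \<gamma> t $ 1 + l2 * \<gamma> t $ 2 * curve_deriv \<gamma> t $ 2)
    = l1 * \<gamma> t $ 1 * (weight l1 l2 (\<gamma> t) * curve_deriv \<gamma> t $ 1) + l2 * \<gamma> t $ 2 * (weight l1 l2 (\<gamma> t) * curve_deriv \<gamma> t $ 2)"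
    by (simp add: algebra_simps)
  also have "\<dots> = norm (curve_deriv \<gamma> t) * (l1 * \<gamma> t $ 1 * (system_matrix l1 l2 \<beta> *v \<gamma> t) $ 1 + l2 * \<gamma> t $ 2 * (system_matrix l1 l2 \<beta> *v \<gamma> t) $ 2)"
    unfolding p by (simp add: algebra_simps)
  also have "\<dots> = weight l1 l2 (\<gamma> t) * (- sin \<beta> * weight l1 l2 (\<gamma> t) * norm (curve_deriv \<gamma> t))"
    unfolding gradient_inner_system by (simp add: power2_eq_square)
  finally show ?thesis using w by (simp only: mult_cancel_left) simp
qed

lemma rtilde_antimono:
  assumes st: "0 \<le> s" "s \<le> t" "t \<le> 1"
  shows "rtilde l1 l2 (\<gamma> t) \<le> rtilde l1 l2 (\<gamma> s)"
proof -
  obtain K where K: "K-lipschitz_on {0..1} (\<lambda>t. rtilde l1 l2 (\<gamma> t))"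
    by (rule lipschitz_on_rtilde_curve[OF lip])
  show ?thesis
  proof (rule lipschitz_ae_nonpos_derivative_imp_antimono[OF K N _ _ st])
    fix u assume u: "u \<in> {0..1} - N"
    show "((\<lambda>t. rtilde l1 l2 (\<gamma> t)) has_real_derivative
        - sin \<beta> * weight l1 l2 (\<gamma> u) * norm (curve_deriv \<gamma> u)) (at u within {0..1})"
      using has_real_derivative_rtilde[OF deriv[OF u], of l1 l2] unfolding gradient_inner_curve_deriv[OF u] .
    show "- sin \<beta> * weight l1 l2 (\<gamma> u) * norm (curve_deriv \<gamma> u) \<le> 0"
      using sin_gt_zero[OF beta] weight_nonneg[of l1 l2] by simp
  qed
qed

text \<open>
  As long as the curve has not reached the origin, its length weighted by \<open>1 / F\<close> is a clock in which it satisfies the linear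
  system almost everywhere. Uniqueness of the solution follows from the Lyapunov function.
\<close>

lemma on_solution:
  assumes x: "\<And>t. (x has_vector_derivative system_matrix l1 l2 \<beta> *v x t) (at t)" and x0: "x 0 = \<gamma> 0"
    and t1: "t1 \<in> {0..1}" and nz: "\<gamma> t1 \<noteq> 0"
  obtains u where "u \<ge> 0" "\<gamma> t1 = x u"
proof (cases "t1 = 0")
  case True
  then show ?thesis using that[of 0] x0 by simp
next
  case False
  with t1 have t1': "0 < t1" "t1 \<le> 1" by auto
  let ?M = "\<lambda>p. system_matrix l1 l2 \<beta> *v p"
  have sub: "{0..t1} \<subseteq> {0..1}" using t1' by auto
  have "rtilde l1 l2 (\<gamma> t) > 0" if "t \<in> {0..t1}" for t
    using rtilde_antimono[of t t1] that t1' nz rtilde_pos_iff[OF l1 l2, of "\<gamma> t1"] by auto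
  then have \<gamma>nz: "\<gamma> t \<noteq> 0" if "t \<in> {0..t1}" for t
    using that rtilde_pos_iff[OF l1 l2, of "\<gamma> t"] by auto
  have lip1: "L-lipschitz_on {0..t1} \<gamma>" by (rule lipschitz_on_subset[OF lip sub])
  have cont: "continuous_on {0..t1} (\<lambda>t. weight l1 l2 (\<gamma> t))"
    by (rule continuous_on_compose2[OF continuous_weight[of UNIV] lipschitz_on_continuous_on[OF lip1]]) simp
  have wpos: "weight l1 l2 (\<gamma> t) > 0" if "t \<in> {0..t1}" for t
    using \<gamma>nz[OF that] weight_eq_0_iff[OF l1 l2, of "\<gamma> t"] weight_nonneg[of l1 l2 "\<gamma> t"] by auto
  obtain tm where tm: "tm \<in> {0..t1}" "\<And>t. t \<in> {0..t1} \<Longrightarrow> weight l1 l2 (\<gamma> tm) \<le> weight l1 l2 (\<gamma> t)"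
    using continuous_attains_inf[OF compact_Icc _ cont] t1' by auto
  \<comment> \<open>A positive lower bound for the weight on \<open>{0..t1}\<close> makes the clock \<open>\<sigma>\<close> Lipschitz.\<close>
  define f0 where "f0 = weight l1 l2 (\<gamma> tm)"
  have f0: "f0 > 0" using wpos[OF tm(1)] by (simp add: f0_def)
  define h where "h t = inverse (weight l1 l2 (\<gamma> t)) * norm (curve_deriv \<gamma> t)" for t
  have hint: "h integrable_on {0..t1}"
    unfolding h_def
  proof (rule continuous_mult_absolutely_integrable)
    show "continuous_on {0..t1} (\<lambda>t. inverse (weight l1 l2 (\<gamma> t)))"
      using cont wpos by (intro continuous_on_inverse) force+
    have "curve_deriv \<gamma> absolutely_integrable_on {0..1}"
      using lipschitz_derivative_absolutely_integrable[OF lip] by simp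
    then have "(\<lambda>t. norm (curve_deriv \<gamma> t)) absolutely_integrable_on {0..1}"
      by (rule absolutely_integrable_norm[unfolded o_def])
    then show "(\<lambda>t. norm (curve_deriv \<gamma> t)) absolutely_integrable_on {0..t1}"
      by (rule absolutely_integrable_on_subinterval) (rule sub)
  qed
  have h0: "h t \<ge> 0" for t using weight_nonneg[of l1 l2 "\<gamma> t"] by (simp add: h_def)
  have L0: "L \<ge> 0" using lip by (rule lipschitz_on_nonneg)
  have hbd: "h t \<le> inverse f0 * L" if "t \<in> {0..t1} - N" for t
  proof -
    have "inverse (weight l1 l2 (\<gamma> t)) \<le> inverse f0"
      using tm(2)[of t] f0 that by (intro le_imp_inverse_le) (auto simp: f0_def)
    moreover have "norm (curve_deriv \<gamma> t) \<le> L"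
      by (rule lipschitz_derivative_bound[OF lip _ zero_less_one deriv]) (use that sub in auto)
    ultimately show ?thesis unfolding h_def using f0 by (intro mult_mono) auto
  qed
  define \<sigma> where "\<sigma> t = integral {0..t} h" for t
  have \<sigma>diff: "0 \<le> \<sigma> t - \<sigma> s \<and> \<sigma> t - \<sigma> s \<le> inverse f0 * L * (t - s)" if "0 \<le> s" "s \<le> t" "t \<le> t1" for s t
  proof -
    have i: "h integrable_on {0..t}" "h integrable_on {s..t}"
      using integrable_on_subinterval[OF hint] that by auto
    have eq: "\<sigma> t - \<sigma> s = integral {s..t} h"
      using Henstock_Kurzweil_Integration.integral_combine[OF that(1,2) i(1)] by (simp add: \<sigma>_def)
    have "integral {s..t} h \<ge> 0" using i(2) h0 by (rule Henstock_Kurzweil_Integration.integral_nonneg)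
    moreover have "integral {s..t} h \<le> (t - s) *\<^sub>R (inverse f0 * L)"
      using has_integral_mono_ae[OF integrable_integral[OF i(2)] has_integral_const_real N] hbd that by auto
    ultimately show ?thesis unfolding eq by (simp add: mult.commute)
  qed
  have \<sigma>lip: "(inverse f0 * L)-lipschitz_on {0..t1} \<sigma>"
  proof (rule lipschitz_on_leI)
    fix s t assume "s \<in> {0..t1}" "t \<in> {0..t1}" "s \<le> t"
    then show "dist (\<sigma> s) (\<sigma> t) \<le> inverse f0 * L * dist s t"
      using \<sigma>diff[of s t] by (auto simp: dist_real_def)
  qed (use f0 L0 in simp)
  have \<sigma>0: "\<sigma> 0 = 0" by (simp add: \<sigma>_def)
  have \<sigma>ge: "\<sigma> t1 \<ge> 0" using \<sigma>diff[of 0 t1] t1' \<sigma>0 by simp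
  obtain N2 where N2: "negligible N2" and \<sigma>d: "\<And>t. t \<in> {0..t1} - N2 \<Longrightarrow> (\<sigma> has_vector_derivative h t) (at t within {0..t1})"
    by (rule ae_derivative_of_indefinite_integral[OF hint, folded \<sigma>_def]) (rule that)
  \<comment> \<open>With the clock \<open>\<sigma>\<close>, \<open>\<gamma>\<close> and \<open>x \<circ> \<sigma>\<close> solve the same linear equation with the rate \<open>h\<close>, hence so does
    their difference, and the quadratic form decreases along it from the initial value 0.\<close>
  define w where "w t = \<gamma> t - x (\<sigma> t)" for t
  have "\<sigma> ` {0..t1} \<subseteq> {0..\<sigma> t1}" using \<sigma>diff[of 0] \<sigma>diff[of _ t1] t1' \<sigma>0 by force
  moreover obtain B where "B-lipschitz_on {0..\<sigma> t1} x" by (rule lipschitz_on_ode_solution[OF x])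
  ultimately have "B-lipschitz_on (\<sigma> ` {0..t1}) x" by (blast intro: lipschitz_on_subset)
  from lipschitz_on_diff[OF lip1 lipschitz_on_compose2[OF \<sigma>lip this]]
  have wlip: "(L + B * (inverse f0 * L))-lipschitz_on {0..t1} w" by (simp add: w_def[abs_def])
  have wd: "(w has_vector_derivative h t *\<^sub>R ?M (w t)) (at t within {0..t1})" if t: "t \<in> {0..t1} - (N \<union> N2)" for t
  proof -
    have tN: "t \<in> {0..1} - N" using t sub by auto
    have "((\<lambda>t. x (\<sigma> t)) has_vector_derivative h t *\<^sub>R ?M (x (\<sigma> t))) (at t within {0..t1})"
      using vector_diff_chain_within[OF \<sigma>d has_vector_derivative_at_within[OF x]] t by (auto simp: o_def)
    moreover have "(\<gamma> has_vector_derivative curve_deriv \<gamma> t) (at t within {0..t1})"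
      by (rule has_vector_derivative_within_subset[OF deriv[OF tN] sub])
    ultimately have "(w has_vector_derivative curve_deriv \<gamma> t - h t *\<^sub>R ?M (x (\<sigma> t))) (at t within {0..t1})"
      unfolding w_def by (intro has_vector_derivative_diff)
    moreover have "curve_deriv \<gamma> t = h t *\<^sub>R ?M (\<gamma> t)"
    proof -
      have "h t *\<^sub>R ?M (\<gamma> t) = inverse (weight l1 l2 (\<gamma> t)) *\<^sub>R (norm (curve_deriv \<gamma> t) *\<^sub>R ?M (\<gamma> t))"
        by (simp add: h_def)
      also have "\<dots> = curve_deriv \<gamma> t"
        unfolding parallel[OF tN, symmetric] using wpos[of t] t by simp
      finally show ?thesis by simp
    qed
    ultimately show ?thesis
      by (simp add: w_def matrix_vector_mult_diff_distrib scaleR_diff_right)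
  qed
  obtain K where K: "K-lipschitz_on {0..t1} (\<lambda>t. rtilde l1 l2 (w t))"
    by (rule lipschitz_on_rtilde_curve[OF wlip])
  have "rtilde l1 l2 (w t1) \<le> rtilde l1 l2 (w 0)"
  proof (rule lipschitz_ae_nonpos_derivative_imp_antimono[OF K negligible_Un[OF N N2]])
    fix t assume t: "t \<in> {0..t1} - (N \<union> N2)"
    show "((\<lambda>t. rtilde l1 l2 (w t)) has_real_derivative (h t * (- sin \<beta> * (weight l1 l2 (w t))\<^sup>2))) (at t within {0..t1})"
      using has_real_derivative_rtilde[OF wd[OF t], of l1 l2]
      unfolding gradient_inner_system[symmetric] by (simp add: algebra_simps)
    show "h t * (- sin \<beta> * (weight l1 l2 (w t))\<^sup>2) \<le> 0"
      using h0[of t] sin_gt_zero[OF beta] by (simp add: mult_nonneg_nonpos)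
  qed (use t1' in auto)
  also have "rtilde l1 l2 (w 0) = 0" by (simp add: w_def \<sigma>0 x0)
  finally have "w t1 = 0"
    using rtilde_nonneg[OF l1 l2, of "w t1"] rtilde_eq_0_iff[OF l1 l2, of "w t1"] by simp
  then show ?thesis using that[OF \<sigma>ge] by (simp add: w_def)
qed

text \<open>
  The speed is bounded by the rate at which the square root of the quadratic form decreases, up to a constant factor.
\<close>

lemma arclength_le:
  assumes "\<gamma> 1 = 0"
  shows "arclength \<gamma> \<le> sqrt (2 * rtilde l1 l2 (\<gamma> 0) / min l1 l2) / sin \<beta>"
proof -
  have antimono: "rtilde l1 l2 (\<gamma> t) \<le> rtilde l1 l2 (\<gamma> s)" if "0 \<le> s" "s \<le> t" "t \<le> 1" for s t
    by (rule rtilde_antimono[OF that])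
  have sb: "sin \<beta> > 0" using beta by (rule sin_gt_zero)
  have mn: "min l1 l2 > 0" using l1 l2 by simp
  define T :: "real^2 \<Rightarrow> real^2" where "T p = vector [sqrt l1 * p$1, sqrt l2 * p$2]" for p
  have T: "norm (T p) = sqrt (2 * rtilde l1 l2 p)" for p
    unfolding T_def rtilde_def norm_eq_sqrt_inner inner_real2
    using l1 l2 by (simp add: power2_eq_square[symmetric] power_mult_distrib)
  have Tdiff: "T p - T q = T (p - q)" for p q
    by (simp add: T_def vec_eq_iff forall_2 algebra_simps)
  have Tbound: "norm (T p) \<le> sqrt (max l1 l2) * norm p" for p
  proof (rule power2_le_imp_le)
    have "(norm (T p))\<^sup>2 = l1 * (p$1)\<^sup>2 + l2 * (p$2)\<^sup>2"
      unfolding T using rtilde_nonneg[OF l1 l2, of p] by (simp add: rtilde_def)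
    also have "\<dots> \<le> max l1 l2 * (p$1)\<^sup>2 + max l1 l2 * (p$2)\<^sup>2"
      by (intro add_mono mult_right_mono) auto
    also have "\<dots> = (sqrt (max l1 l2) * norm p)\<^sup>2"
      unfolding power_mult_distrib power2_norm_eq_inner inner_real2
      using l1 l2 by (simp add: power2_eq_square algebra_simps)
    finally show "(norm (T p))\<^sup>2 \<le> (sqrt (max l1 l2) * norm p)\<^sup>2" .
  qed (use l1 l2 in auto)
  \<comment> \<open>\<open>n\<close> is the square root of twice the quadratic form along \<open>\<gamma>\<close>. It is a norm of \<open>\<gamma>\<close>, therefore Lipschitz
    even where \<open>\<gamma>\<close> vanishes.\<close>
  define n where "n t = norm (T (\<gamma> t))" for t
  have nlip: "(sqrt (max l1 l2) * L)-lipschitz_on {0..1} n"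
  proof (rule lipschitz_onI)
    have L0: "L \<ge> 0" using lip by (rule lipschitz_on_nonneg)
    then show "0 \<le> sqrt (max l1 l2) * L" using l1 by simp
    fix s t :: real assume st: "s \<in> {0..1}" "t \<in> {0..1}"
    have "dist (n s) (n t) \<le> norm (T (\<gamma> s) - T (\<gamma> t))"
      unfolding n_def dist_real_def by (rule norm_triangle_ineq3)
    also have "\<dots> \<le> sqrt (max l1 l2) * dist (\<gamma> s) (\<gamma> t)" unfolding Tdiff dist_norm by (rule Tbound)
    also have "\<dots> \<le> sqrt (max l1 l2) * (L * dist s t)"
      using lipschitz_onD[OF lip st] l1 by (intro mult_left_mono) auto
    finally show "dist (n s) (n t) \<le> sqrt (max l1 l2) * L * dist s t" by (simp add: mult.assoc)
  qed
  obtain h N2 where N2: "negligible N2"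
    and nd: "\<And>t. t \<in> {0..1} - N2 \<Longrightarrow> (n has_vector_derivative h t) (at t within {0..1})"
    and hint: "(h has_integral (n 1 - n 0)) {0..1}"
    by (rule lipschitz_fundamental_theorem[OF nlip zero_le_one]) (rule that)
  note unique = vector_derivative_unique_within_closed_interval[unfolded cbox_interval]
  define C where "C = 1 / (sin \<beta> * sqrt (min l1 l2))"
  have "arclength \<gamma> \<le> C * - (n 1 - n 0)"
    unfolding arclength_def
  proof (rule has_integral_mono_ae)
    show "((\<lambda>t. norm (curve_deriv \<gamma> t)) has_integral integral {0..1} (\<lambda>t. norm (curve_deriv \<gamma> t))) {0..1}"
      using curve_integrable(1)[OF lip continuous_on_const[of _ 1]] by (simp add: integrable_integral)
    show "((\<lambda>t. C * - h t) has_integral C * - (n 1 - n 0)) {0..1}"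
      by (intro has_integral_mult_right has_integral_neg hint)
    show "negligible (N \<union> N2 \<union> {1})" by (intro negligible_Un N N2 negligible_sing)
    fix t assume t: "t \<in> {0..1} - (N \<union> N2 \<union> {1})"
    then have tN: "t \<in> {0..1} - N" and tN2: "t \<in> {0..1} - N2" and t01: "0 \<le> t" "t < 1" by auto
    show "norm (curve_deriv \<gamma> t) \<le> C * - h t"
    proof (cases "\<gamma> t = 0")
      case True
      \<comment> \<open>Once at the origin, \<open>\<gamma>\<close> stays there, and both derivatives, computed from the right, vanish. The point 1 has no
        right neighbourhood in the unit interval and was put into the exceptional set.\<close>
      have z: "\<gamma> u = 0" if "u \<in> {t..1}" for u
        using antimono[of t u] that t01 True rtilde_pos_iff[OF l1 l2, of "\<gamma> u"] by auto
      have T0: "T 0 = 0" by (simp add: T_def vec_eq_iff forall_2)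
      have sub: "{t..1} \<subseteq> {0..1}" and tt: "t \<in> {t..1}" using t01 by auto
      have c0: "(\<gamma> has_vector_derivative 0) (at t within {t..1})"
        by (rule has_vector_derivative_transform[OF _ _ has_vector_derivative_const[of 0]]) (use t01 z in auto)
      have n0: "(n has_vector_derivative 0) (at t within {t..1})"
        by (rule has_vector_derivative_transform[OF _ _ has_vector_derivative_const[of 0]]) (use t01 z T0 in \<open>auto simp: n_def\<close>)
      have "curve_deriv \<gamma> t = 0"
        by (rule unique[OF t01(2) tt has_vector_derivative_within_subset[OF deriv[OF tN] sub] c0])
      moreover have "h t = 0"
        by (rule unique[OF t01(2) tt has_vector_derivative_within_subset[OF nd[OF tN2] sub] n0])
      ultimately show ?thesis by simp
    next
      case False
      let ?w = "weight l1 l2 (\<gamma> t)" and ?v = "norm (curve_deriv \<gamma> t)"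
      have rpos: "rtilde l1 l2 (\<gamma> t) > 0" using False rtilde_pos_iff[OF l1 l2] by simp
      then have npos: "n t > 0" by (simp add: n_def T)
      have gd: "l1 * \<gamma> t $ 1 * curve_deriv \<gamma> t $ 1 + l2 * \<gamma> t $ 2 * curve_deriv \<gamma> t $ 2 = - sin \<beta> * ?w * ?v"
        by (rule gradient_inner_curve_deriv[OF tN])
      have gd: "l1 * \<gamma> t $ 1 * curve_deriv \<gamma> t $ 1 + l2 * \<gamma> t $ 2 * curve_deriv \<gamma> t $ 2 = - sin \<beta> * ?w * ?v"
        by (rule gradient_inner_curve_deriv[OF tN])
      have gd: "l1 * \<gamma> t $ 1 * curve_deriv \<gamma> t $ 1 + l2 * \<gamma> t $ 2 * curve_deriv \<gamma> t $ 2 = - sin \<beta> * ?w * ?v"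
        by (rule gradient_inner_curve_deriv[OF tN])
      have gd: "l1 * \<gamma> t $ 1 * curve_deriv \<gamma> t $ 1 + l2 * \<gamma> t $ 2 * curve_deriv \<gamma> t $ 2 = - sin \<beta> * ?w * ?v"
        by (rule gradient_inner_curve_deriv[OF tN])
      have "((\<lambda>t. rtilde l1 l2 (\<gamma> t)) has_real_derivative - sin \<beta> * ?w * ?v) (at t within {0..1})"
        using has_real_derivative_rtilde[OF deriv[OF tN], of l1 l2] 
        unfolding gd .
      from DERIV_cmult[OF this, of 2]
      have "((\<lambda>t. 2 * rtilde l1 l2 (\<gamma> t)) has_real_derivative 2 * (- sin \<beta> * ?w * ?v)) (at t within {0..1})" .
      from DERIV_chain2[OF DERIV_real_sqrt this] rpos
      have "((\<lambda>t. sqrt (2 * rtilde l1 l2 (\<gamma> t))) has_real_derivative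
          inverse (sqrt (2 * rtilde l1 l2 (\<gamma> t))) / 2 * (2 * (- sin \<beta> * ?w * ?v))) (at t within {0..1})"
        by simp
      then have nn: "(n has_vector_derivative inverse (n t) / 2 * (2 * (- sin \<beta> * ?w * ?v))) (at t within {0..1})"
        unfolding has_real_derivative_iff_has_vector_derivative n_def T .
      have ht: "h t = inverse (n t) / 2 * (2 * (- sin \<beta> * ?w * ?v))"
        by (rule unique[OF zero_less_one _ nd[OF tN2] nn]) (use t01 in simp)
      have h: "- h t = sin \<beta> * ?v * (?w / n t)"
        unfolding ht using npos by (simp add: field_simps)
      have "sqrt (min l1 l2) * n t \<le> ?w"
      proof (rule power2_le_imp_le)
        show "(sqrt (min l1 l2) * n t)\<^sup>2 \<le> ?w\<^sup>2"
          using weight_squared_ge[OF l1 l2, of "\<gamma> t"] mn rpos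
          by (simp add: n_def T power_mult_distrib algebra_simps)
      qed (rule weight_nonneg)
      then have "sqrt (min l1 l2) \<le> ?w / n t" using npos by (simp add: pos_le_divide_eq)
      then have "sin \<beta> * ?v * sqrt (min l1 l2) \<le> - h t"
        unfolding h using sb by (intro mult_left_mono) auto
      then show ?thesis using sb mn by (simp add: C_def field_simps)
    qed
  qed
  also have "n 1 = 0" using assms by (simp add: n_def T)
  also have "C * - (0 - n 0) = sqrt (2 * rtilde l1 l2 (\<gamma> 0) / min l1 l2) / sin \<beta>"
    by (simp add: C_def n_def T real_sqrt_divide)
  finally show ?thesis .
qed

end

section \<open>Minimizers\<close>

text \<open>
  A function \<open>R\<close> that decreases strictly along \<open>c\<close> is a coordinate on the trace of \<open>c\<close>. The point \<open>\<gamma> t\<close>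
  is located on \<open>c\<close> by its value of \<open>R\<close>, which depends continuously and monotonically on \<open>t\<close>.
\<close>

lemma monotone_reparam_of_common_trace:
  assumes c: "continuous_on {0..1} c" and \<gamma>: "continuous_on {0..1} \<gamma>"
    and R: "continuous_on UNIV R"
    and ends: "\<gamma> 0 = c 0" "\<gamma> 1 = c 1"
    and cdec: "\<And>s t. 0 \<le> s \<Longrightarrow> s < t \<Longrightarrow> t \<le> 1 \<Longrightarrow> R (c t) < (R (c s) :: real)"
    and \<gamma>dec: "\<And>s t. 0 \<le> s \<Longrightarrow> s \<le> t \<Longrightarrow> t \<le> 1 \<Longrightarrow> R (\<gamma> t) \<le> R (\<gamma> s)"
    and tr: "\<gamma> ` {0..1} \<subseteq> c ` {0..1}"
  obtains \<phi> where "monotone_reparam \<phi>" "\<And>t. t \<in> {0..1} \<Longrightarrow> \<gamma> t = c (\<phi> t)" "\<gamma> ` {0..1} = c ` {0..1}"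
proof -
  let ?I = "{0..1::real}"
  have inj: "s = t" if "s \<in> ?I" "t \<in> ?I" "R (c s) = R (c t)" for s t
    using cdec[of s t] cdec[of t s] that by (cases s t rule: linorder_cases) auto
  define g where "g = the_inv_into ?I (\<lambda>u. R (c u))"
  have injon: "inj_on (\<lambda>u. R (c u)) ?I" using inj by (auto intro: inj_onI)
  have gc: "g (R (c u)) = u" if "u \<in> ?I" for u
    unfolding g_def using the_inv_into_f_f[OF injon that] .
  have Rc: "continuous_on ?I (\<lambda>u. R (c u))" by (rule continuous_on_compose2[OF R c]) simp
  have gcont: "continuous_on ((\<lambda>u. R (c u)) ` ?I) g"
    by (rule continuous_on_inv[OF Rc compact_Icc]) (use gc in auto)
  define \<phi> where "\<phi> t = g (R (\<gamma> t))" for t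
  have key: "\<phi> t \<in> ?I \<and> \<gamma> t = c (\<phi> t)" if t: "t \<in> ?I" for t
  proof -
    obtain u where "u \<in> ?I" "\<gamma> t = c u" using tr t by blast
    then show ?thesis using gc by (simp add: \<phi>_def)
  qed
  have 01: "\<phi> 0 = 0" "\<phi> 1 = 1" using gc[of 0] gc[of 1] by (simp_all add: \<phi>_def ends)
  have R\<gamma>: "continuous_on ?I (\<lambda>t. R (\<gamma> t))" by (rule continuous_on_compose2[OF R \<gamma>]) simp
  have cont: "continuous_on ?I \<phi>"
    unfolding \<phi>_def by (rule continuous_on_compose2[OF gcont R\<gamma>]) (use tr in auto)
  have "mono_on ?I \<phi>"
  proof (rule mono_onI)
    fix s t assume st: "s \<in> ?I" "t \<in> ?I" "s \<le> t"
    show "\<phi> s \<le> \<phi> t"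
    proof (rule ccontr)
      assume "\<not> \<phi> s \<le> \<phi> t"
      then have "R (c (\<phi> s)) < R (c (\<phi> t))" using key[of s] key[of t] st by (intro cdec) auto
      then show False using \<gamma>dec[of s t] key[of s] key[of t] st by auto
    qed
  qed
  then have mr: "monotone_reparam \<phi>" using cont 01 by (simp add: monotone_reparam_def)
  have "c ` ?I \<subseteq> \<gamma> ` ?I"
  proof
    fix p assume "p \<in> c ` ?I"
    then obtain u where u: "u \<in> ?I" "p = c u" by blast
    obtain t where "t \<in> ?I" "\<phi> t = u" using IVT'[of \<phi> 0 u 1] cont 01 u by auto
    then show "p \<in> \<gamma> ` ?I" using key[of t] u by (intro image_eqI[of _ _ t]) auto
  qed
  then show thesis using that[OF mr] key tr by blast
qed

lemma cot_parameter_exists: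
  obtains \<beta> where "0 < \<beta>" "\<beta> < pi" "cot \<beta> = c"
proof
  let ?b = "pi / 2 - arctan c"
  show "0 < ?b" "?b < pi" using arctan_bounded[of c] by linarith+
  have "cos ?b = sin (arctan c)" "sin ?b = cos (arctan c)" by (simp_all add: cos_diff sin_diff)
  then show "cot ?b = c" using tan_arctan[of c] by (simp add: cot_def tan_def)
qed

lemma inverse_sin_le:
  assumes "0 < \<beta>" "\<beta> < pi"
  shows "1 / sin \<beta> \<le> 1 + \<bar>cot \<beta>\<bar>"
proof -
  have s: "sin \<beta> > 0" using assms by (rule sin_gt_zero)
  have "1 = (sin \<beta>)\<^sup>2 + \<bar>cos \<beta>\<bar>\<^sup>2" by simp
  also have "\<dots> \<le> sin \<beta> * 1 + \<bar>cos \<beta>\<bar> * 1"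
    unfolding power2_eq_square using s by (intro add_mono mult_left_mono) auto
  finally have "1 \<le> sin \<beta> + \<bar>cos \<beta>\<bar>" by simp
  then have "1 / sin \<beta> \<le> (sin \<beta> + \<bar>cos \<beta>\<bar>) / sin \<beta>" using s by (intro divide_right_mono) auto
  also have "\<dots> = 1 + \<bar>cot \<beta>\<bar>" using s by (simp add: cot_def add_divide_distrib)
  finally show ?thesis .
qed

text \<open>
  \<^const>\<open>Atilde\<close> involves the product of the coordinates of \<open>p0\<close>; the inequality of arithmetic and geometric means bounds it
  by the quadratic form. This is why the length bound depends on \<open>p0\<close> only through that form.
\<close>

lemma abs_Atilde_le:
  assumes l1: "l1 > 0" and l2: "l2 > 0"
  shows "(l1 + l2) * \<bar>Atilde l1 l2 A p0\<bar> \<le> (l1 + l2) * \<bar>A\<bar> + l1 * rtilde l1 l2 p0 / sqrt (l1 * l2)"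
proof -
  have l: "l1 + l2 > 0" using l1 l2 by simp
  have sq: "sqrt (l1 * l2) > 0" using l1 l2 by simp
  have "0 \<le> (sqrt l1 * \<bar>p0$1\<bar> - sqrt l2 * \<bar>p0$2\<bar>)\<^sup>2" by simp
  also have "\<dots> = 2 * (rtilde l1 l2 p0 - sqrt (l1 * l2) * \<bar>p0$1 * p0$2\<bar>)"
    using l1 l2 by (simp add: rtilde_def power2_diff power_mult_distrib real_sqrt_mult abs_mult algebra_simps)
  finally have "\<bar>p0$1 * p0$2\<bar> \<le> rtilde l1 l2 p0 / sqrt (l1 * l2)"
    using sq by (simp add: pos_le_divide_eq mult.commute)
  then have 1: "l1 * \<bar>p0$1 * p0$2\<bar> \<le> l1 * (rtilde l1 l2 p0 / sqrt (l1 * l2))"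
    using l1 by (intro mult_left_mono) auto
  have "(l1 + l2) * \<bar>Atilde l1 l2 A p0\<bar> = \<bar>(l1 + l2) * A - l1 * (p0 $ 1 * p0 $ 2)\<bar>"
    using Atilde_eq[OF l, of A p0] l by (metis abs_mult abs_of_pos mult.assoc)
  also have "\<dots> \<le> \<bar>(l1 + l2) * A\<bar> + \<bar>l1 * (p0 $ 1 * p0 $ 2)\<bar>" by (rule abs_triangle_ineq4)
  also have "\<dots> = (l1 + l2) * \<bar>A\<bar> + l1 * \<bar>p0$1 * p0$2\<bar>" using l l1 by (simp add: abs_mult)
  finally show ?thesis using 1 by simp
qed

text \<open>
  The square root is the bound that \<open>arclength_le\<close> yields at the angle \<open>pi / 2\<close>; the other factor bounds \<open>1 / sin \<beta>\<close>.
\<close>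

definition arclength_bound :: "real \<Rightarrow> real \<Rightarrow> real \<Rightarrow> real \<Rightarrow> real" where
  "arclength_bound A r l1 l2 =
     sqrt (2 * r / min l1 l2) * (1 + ((l1 + l2) * \<bar>A\<bar> + l1 * r / sqrt (l1 * l2)) / r)"

text \<open>
  One curve \<open>c\<close>, the spiral at the prescribed angle, carries all minimizers.
\<close>

lemma minimizer_characterization:
  assumes l1: "l1 > 0" and l2: "l2 > 0" and p0: "p0 \<noteq> 0"
  obtains c where "minimizer l1 l2 A p0 c" "continuous_on {0..1} c"
    "\<And>\<gamma>. minimizer l1 l2 A p0 \<gamma> \<Longrightarrow> \<exists>\<phi>. monotone_reparam \<phi> \<and> (\<forall>t\<in>{0..1}. \<gamma> t = c (\<phi> t))"
    "\<And>\<gamma>. minimizer l1 l2 A p0 \<gamma> \<Longrightarrow> has_spiral_trace l1 l2 A p0 \<gamma>"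
    "\<And>\<gamma>. minimizer l1 l2 A p0 \<gamma> \<Longrightarrow> arclength \<gamma> \<le> arclength_bound A (rtilde l1 l2 p0) l1 l2"
proof -
  have l: "l1 + l2 > 0" using l1 l2 by simp
  let ?r = "rtilde l1 l2 p0" and ?At = "Atilde l1 l2 A p0"
  have r: "?r > 0" using p0 rtilde_pos_iff[OF l1 l2] by simp
  obtain \<beta> where beta: "0 < \<beta>" "\<beta> < pi" and cot: "cot \<beta> = (l1 + l2) * ?At / ?r"
    by (rule cot_parameter_exists)
  have sb: "sin \<beta> > 0" using beta by (rule sin_gt_zero)
  have cs: "cos \<beta> * ?r = sin \<beta> * ((l1 + l2) * ?At)"
    using cot sb r by (simp add: cot_def field_simps)
  \<comment> \<open>The calibrated lower bound at this angle; it is the minimal energy.\<close>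
  define E where "E = sin \<beta> * ?r + cos \<beta> * (l1 + l2) * ?At"
  obtain x c L where x0: "x 0 = p0" and x: "\<And>t. (x has_vector_derivative system_matrix l1 l2 \<beta> *v x t) (at t)"
    and xlim: "(x \<longlongrightarrow> 0) at_top" and clip: "L-lipschitz_on {0..1} c" and c0: "c 0 = p0" and c1: "c 1 = 0"
    and img: "c ` {0..1} = insert 0 (x ` {0..})"
    and cd: "\<And>t. 0 \<le> t \<Longrightarrow> t < 1 \<Longrightarrow> \<exists>k\<ge>0. (c has_vector_derivative k *\<^sub>R (system_matrix l1 l2 \<beta> *v c t)) (at t)"
    and cdec: "\<And>s t. 0 \<le> s \<Longrightarrow> s < t \<Longrightarrow> t \<le> 1 \<Longrightarrow> rtilde l1 l2 (c t) < rtilde l1 l2 (c s)"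
    by (rule spiral_curve[OF l1 l2 beta p0]) (rule that)
  have ccont: "continuous_on {0..1} c" by (rule lipschitz_on_continuous_on[OF clip])
  note ae = solution_curve_area_energy[OF l clip c0 c1 cd]
  have "sin \<beta> * ((l1 + l2) * Atilde l1 l2 (area c) p0) = sin \<beta> * ((l1 + l2) * ?At)"
    using ae(1) cs by simp
  then have "(l1 + l2) * Atilde l1 l2 (area c) p0 = (l1 + l2) * ?At" using sb by simp
  then have areac: "area c = A" unfolding Atilde_eq[OF l] using l by simp
  have cadm: "c \<in> admissible A p0"
    using lipschitz_imp_locally_lipschitz_on[OF clip] c0 c1 areac by (simp add: admissible_def)
  have cE: "energy (weight l1 l2) c = E" using ae(2) by (simp add: areac E_def)
  have lower: "E \<le> energy (weight l1 l2) \<eta>" if "\<eta> \<in> admissible A p0" for \<eta>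
  proof -
    from that have \<eta>: "locally_lipschitz_on {0..1} \<eta>" "\<eta> 0 = p0" "\<eta> 1 = 0" "area \<eta> = A"
      by (auto simp: admissible_def)
    obtain K where "K-lipschitz_on {0..1} \<eta>" by (rule locally_lipschitz_on_unit_interval[OF \<eta>(1)])
    from calibration_inequality[OF this \<eta>(2,3) l, of \<beta>] show ?thesis by (simp add: E_def \<eta>(4))
  qed
  have cmin: "minimizer l1 l2 A p0 c"
    using lower cadm cE by (auto simp: minimizer_def is_arg_min_def not_less)
  have char: "(\<exists>\<phi>. monotone_reparam \<phi> \<and> (\<forall>t\<in>{0..1}. \<gamma> t = c (\<phi> t))) \<and> \<gamma> ` {0..1} = c ` {0..1}
      \<and> arclength \<gamma> \<le> sqrt (2 * ?r / min l1 l2) / sin \<beta>" if "minimizer l1 l2 A p0 \<gamma>" for \<gamma>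
  proof -
    from that have "\<gamma> \<in> admissible A p0" and "energy (weight l1 l2) \<gamma> \<le> E"
      using cadm cE by (auto simp: minimizer_def is_arg_min_def not_less)
    with lower have gE: "energy (weight l1 l2) \<gamma> = E" by force
    from \<open>\<gamma> \<in> admissible A p0\<close> have g: "locally_lipschitz_on {0..1} \<gamma>" "\<gamma> 0 = p0" "\<gamma> 1 = 0" "area \<gamma> = A"
      by (auto simp: admissible_def)
    obtain K where K: "K-lipschitz_on {0..1} \<gamma>" by (rule locally_lipschitz_on_unit_interval[OF g(1)])
    obtain N where N: "negligible N" "\<And>t. t \<in> {0..1} - N \<Longrightarrow>
      (\<gamma> has_vector_derivative curve_deriv \<gamma> t) (at t within {0..1})"
      "\<And>t. t \<in> {0..1} - N \<Longrightarrow> weight l1 l2 (\<gamma> t) *\<^sub>R curve_deriv \<gamma> t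
        = norm (curve_deriv \<gamma> t) *\<^sub>R (system_matrix l1 l2 \<beta> *v \<gamma> t)"
      by (rule calibration_equality[OF K g(2,3) l gE[unfolded E_def g(4)[symmetric]]]) (rule that)
    note H = l1 l2 beta K N
    have "\<gamma> t \<in> c ` {0..1}" if "t \<in> {0..1}" for t
    proof (cases "\<gamma> t = 0")
      case False
      obtain u where "u \<ge> 0" "\<gamma> t = x u"
        by (rule on_solution[OF H x _ \<open>t \<in> {0..1}\<close> False]) (simp_all add: x0 g(2))
      then show ?thesis unfolding img by auto
    qed (simp add: img)
    then have tr: "\<gamma> ` {0..1} \<subseteq> c ` {0..1}" by auto
    obtain \<phi> where "monotone_reparam \<phi>" "\<And>t. t \<in> {0..1} \<Longrightarrow> \<gamma> t = c (\<phi> t)" "\<gamma> ` {0..1} = c ` {0..1}"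
    proof (rule monotone_reparam_of_common_trace[OF ccont lipschitz_on_continuous_on[OF K] continuous_rtilde])
      show "\<gamma> 0 = c 0" "\<gamma> 1 = c 1" by (simp_all add: g c0 c1)
      show "rtilde l1 l2 (c t) < rtilde l1 l2 (c s)" if "0 \<le> s" "s < t" "t \<le> 1" for s t
        by (rule cdec[OF that])
      show "rtilde l1 l2 (\<gamma> t) \<le> rtilde l1 l2 (\<gamma> s)" if "0 \<le> s" "s \<le> t" "t \<le> 1" for s t
        by (rule rtilde_antimono[OF H that])
    qed (rule tr, rule that)
    moreover have "arclength \<gamma> \<le> sqrt (2 * ?r / min l1 l2) / sin \<beta>"
      using arclength_le[OF H g(3)] by (simp add: g(2))
    ultimately show ?thesis by blast
  qed
  have bound: "sqrt (2 * ?r / min l1 l2) / sin \<beta> \<le> arclength_bound A ?r l1 l2"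
  proof -
    have "1 / sin \<beta> \<le> 1 + (l1 + l2) * \<bar>?At\<bar> / ?r"
      using inverse_sin_le[OF beta] l r by (simp add: cot abs_mult)
    also have "\<dots> \<le> 1 + ((l1 + l2) * \<bar>A\<bar> + l1 * ?r / sqrt (l1 * l2)) / ?r"
      using abs_Atilde_le[OF l1 l2, of A p0] r by (intro add_left_mono divide_right_mono) auto
    finally have "sqrt (2 * ?r / min l1 l2) * (1 / sin \<beta>) \<le> arclength_bound A ?r l1 l2"
      unfolding arclength_bound_def using r l1 l2 by (intro mult_left_mono) auto
    then show ?thesis by simp
  qed
  have spiral: "has_spiral_trace l1 l2 A p0 \<gamma>" if "\<gamma> ` {0..1} = c ` {0..1}" for \<gamma>
    unfolding has_spiral_trace_def
  proof (intro exI conjI allI impI)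
    show "?r / (l1 + l2) * cot \<beta> = ?At" using l r by (simp add: cot)
    show "(x has_vector_derivative system_matrix l1 l2 \<beta> *v x t) (at t within {0..})" for t
      by (rule has_vector_derivative_at_within[OF x])
    show "\<gamma> ` {0..1} = insert 0 (x ` {0..})" using that img by simp
  qed (rule beta x0 xlim)+
  show thesis
  proof (rule that[OF cmin ccont])
    fix \<gamma> assume "minimizer l1 l2 A p0 \<gamma>"
    note ch = char[OF this]
    show "\<exists>\<phi>. monotone_reparam \<phi> \<and> (\<forall>t\<in>{0..1}. \<gamma> t = c (\<phi> t))" using ch by (rule conjunct1)
    show "has_spiral_trace l1 l2 A p0 \<gamma>" using ch by (intro spiral) (elim conjE)
    show "arclength \<gamma> \<le> arclength_bound A ?r l1 l2" using ch bound by (elim conjE) (rule order_trans)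
  qed
qed

theorem proposition2p7:
  "\<exists>L0 :: real \<Rightarrow> real \<Rightarrow> real \<Rightarrow> real \<Rightarrow> real.
     \<forall>l1 l2 A. \<forall>p0 :: real^2. l1 > 0 \<longrightarrow> l2 > 0 \<longrightarrow> p0 \<noteq> 0 \<longrightarrow>
       L0 A (rtilde l1 l2 p0) l1 l2 > 0 \<and>
       (\<exists>\<gamma>. minimizer l1 l2 A p0 \<gamma>) \<and>
       (\<forall>\<gamma> \<delta>. minimizer l1 l2 A p0 \<gamma> \<longrightarrow> minimizer l1 l2 A p0 \<delta> \<longrightarrow> same_up_to_reparam \<gamma> \<delta>) \<and>
       (\<forall>\<gamma>. minimizer l1 l2 A p0 \<gamma> \<longrightarrow>
            has_spiral_trace l1 l2 A p0 \<gamma> \<and>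
            arclength \<gamma> \<le> L0 A (rtilde l1 l2 p0) l1 l2)"
proof (rule exI[of _ arclength_bound], intro allI impI)
  fix l1 l2 A :: real and p0 :: "real^2"
  assume l1: "l1 > 0" and l2: "l2 > 0" and p0: "p0 \<noteq> 0"
  obtain c where c: "minimizer l1 l2 A p0 c" "continuous_on {0..1} c"
    "\<And>\<gamma>. minimizer l1 l2 A p0 \<gamma> \<Longrightarrow> \<exists>\<phi>. monotone_reparam \<phi> \<and> (\<forall>t\<in>{0..1}. \<gamma> t = c (\<phi> t))"
    "\<And>\<gamma>. minimizer l1 l2 A p0 \<gamma> \<Longrightarrow> has_spiral_trace l1 l2 A p0 \<gamma>"
    "\<And>\<gamma>. minimizer l1 l2 A p0 \<gamma> \<Longrightarrow> arclength \<gamma> \<le> arclength_bound A (rtilde l1 l2 p0) l1 l2"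
    by (rule minimizer_characterization[OF l1 l2 p0]) (rule that)
  have r: "rtilde l1 l2 p0 > 0" using p0 rtilde_pos_iff[OF l1 l2] by simp
  have "arclength_bound A (rtilde l1 l2 p0) l1 l2 > 0"
    unfolding arclength_bound_def using r l1 l2
    by (intro mult_pos_pos add_pos_nonneg) auto
  moreover have "same_up_to_reparam \<gamma> \<delta>" if "minimizer l1 l2 A p0 \<gamma>" "minimizer l1 l2 A p0 \<delta>" for \<gamma> \<delta>
    unfolding same_up_to_reparam_def using c(2) c(3)[OF that(1)] c(3)[OF that(2)] by blast
  ultimately show "arclength_bound A (rtilde l1 l2 p0) l1 l2 > 0 \<and>
       (\<exists>\<gamma>. minimizer l1 l2 A p0 \<gamma>) \<and>
       (\<forall>\<gamma> \<delta>. minimizer l1 l2 A p0 \<gamma> \<longrightarrow> minimizer l1 l2 A p0 \<delta> \<longrightarrow> same_up_to_reparam \<gamma> \<delta>) \<and>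
       (\<forall>\<gamma>. minimizer l1 l2 A p0 \<gamma> \<longrightarrow>
            has_spiral_trace l1 l2 A p0 \<gamma> \<and>
            arclength \<gamma> \<le> arclength_bound A (rtilde l1 l2 p0) l1 l2)"
    using c(1,4,5) by blast
qed

end
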